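(* Let $\mathsf{e}\ge 1$ be an integer and let $\mathcal{E}=\{E^1,\dots,E^{\mathsf{e}}\}$ be any set of $\mathsf{e}$ feasible brackets for a single-elimination tournament with $\mathsf{t}$ teams. Then the expected maximum score $\mathbb{E}[S(\mathcal{E})]=\mathbb{E}\big[\max_{E\in\mathcal{E}} s(E,O)\big]$, where $O$ is the random tournament outcome, can be computed exactly in time $O\big(\mathsf{t}\cdot(\mathsf{t}\cdot\log_2\mathsf{t})^{2\mathsf{e}+1}\big)$.
   Context: Tournament: there are $\mathsf{t}=2^{\mathsf{r}}$ teams $\mathcal{T}=\{1,\dots,\mathsf{t}\}$ playing a single-elimination tournament with a fixed bracket of $\mathsf{r}$ rounds; round $r$ has $\mathsf{t}/2^r$ games, for $\mathsf{g}=\mathsf{t}-1$ games in total, and $r(g)$ denotes the round of game $g$. Each game $g$ has a set $\mathcal{T}(g)$ of teams that can play in it: the first-round games partition $\mathcal{T}$ into pairs; each game $g$ with $r(g)>1$ has exactly two predecessor games in round $r(g)-1$, whose winners play $g$, and $\mathcal{T}(g)$ is the union of their team sets. For $t\in\mathcal{T}(g)$ with $r(g)>1$, $\gamma^-(g,t)$ is the predecessor game of $g$ with $t\in\mathcal{T}(\gamma^-(g,t))$. A feasible bracket is a matrix $B\in\{0,1\}^{\mathsf{t}\times\mathsf{g}}$ with $\sum_t B_{t,g}=1$ for every game $g$, $B_{t,g}=1$ only if $t\in\mathcal{T}(g)$, and, if $r(g)>1$ and $B_{t,g}=1$, then $B_{t,\gamma^-(g,t)}=1$. Both entries and tournament outcomes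 are feasible brackets. The score of entry $E$ under outcome $O$ is $s(E,O)=\sum_{t\in\mathcal{T}}\sum_{g}2^{r(g)-1}E_{t,g}O_{t,g}$. Probability model (Markov tournament): a matrix $P^{\text{team}}\in[0,1]^{\mathsf{t}\times\mathsf{t}}$ with $P^{\text{team}}_{t,t'}+P^{\text{team}}_{t',t}=1$ for $t\ne t'$ is given; the random outcome $O$ is generated round by round, and in each game between teams $t$ and $t'$ team $t$ wins with probability $P^{\text{team}}_{t,t'}$, independently of everything else. For a set $\mathcal{E}$ of entries, $S(\mathcal{E})=\max_{E\in\mathcal{E}}s(E,O)$. *)

theory Defs
  imports "HOL-Probability.Probability"
begin

section \<open>Single-elimination tournaments\<close>

text \<open>
  Teams are numbered from 1 to \<open>2 ^ rounds\<close> and games, in no particular order, from 1 to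
  \<open>2 ^ rounds - 1\<close>.
\<close>

record bracket_structure =
  rounds :: nat
  game_round :: "nat \<Rightarrow> nat"
  game_teams :: "nat \<Rightarrow> nat set"
  predecessors :: "nat \<Rightarrow> nat set"

definition num_teams :: "bracket_structure \<Rightarrow> nat" where
  "num_teams T = 2 ^ rounds T"

definition teams :: "bracket_structure \<Rightarrow> nat set" where
  "teams T = {1..num_teams T}"

definition games :: "bracket_structure \<Rightarrow> nat set" where
  "games T = {1..num_teams T - 1}"

definition round_games :: "bracket_structure \<Rightarrow> nat \<Rightarrow> nat set" where
  "round_games T k = {g \<in> games T. game_round T g = k}"

text \<open>
  The last conjunct says that the winner of a game advances to only one game. It makes the team
  sets of the games of a round disjoint, so that \<open>predecessor_of\<close> below is well defined.
\<close>

definition tournament :: "bracket_structure \<Rightarrow> bool" where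
  "tournament T \<longleftrightarrow>
     (\<forall>g\<in>games T. game_round T g \<in> {1..rounds T}) \<and>
     (\<forall>k\<in>{1..rounds T}. card (round_games T k) = num_teams T div 2 ^ k) \<and>
     (\<forall>g\<in>round_games T 1. card (game_teams T g) = 2) \<and>
     disjoint_family_on (game_teams T) (round_games T 1) \<and>
     (rounds T \<ge> 1 \<longrightarrow> (\<Union>g\<in>round_games T 1. game_teams T g) = teams T) \<and>
     (\<forall>g\<in>games T. game_round T g > 1 \<longrightarrow>
        predecessors T g \<subseteq> round_games T (game_round T g - 1) \<and>
        card (predecessors T g) = 2 \<and>
        game_teams T g = (\<Union>h\<in>predecessors T g. game_teams T h)) \<and>
     disjoint_family_on (predecessors T) {g \<in> games T. game_round T g > 1}"

definition predecessor_of :: "bracket_structure \<Rightarrow> nat \<Rightarrow> nat \<Rightarrow> nat" where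
  "predecessor_of T g t = (THE h. h \<in> predecessors T g \<and> t \<in> game_teams T h)"

section \<open>Feasible brackets and scores\<close>

text \<open>
  A bracket is a 0/1 matrix indexed by teams and games. Entries outside the index range are
  required to be 0, so that distinct functions are distinct matrices.
\<close>

type_synonym bracket = "nat \<Rightarrow> nat \<Rightarrow> nat"

definition feasible_bracket :: "bracket_structure \<Rightarrow> bracket \<Rightarrow> bool" where
  "feasible_bracket T B \<longleftrightarrow>
     (\<forall>t g. B t g \<in> {0, 1}) \<and>
     (\<forall>t g. t \<notin> teams T \<or> g \<notin> games T \<longrightarrow> B t g = 0) \<and>
     (\<forall>g\<in>games T. (\<Sum>t\<in>teams T. B t g) = 1) \<and>
     (\<forall>t\<in>teams T. \<forall>g\<in>games T. B t g = 1 \<longrightarrow> t \<in> game_teams T g) \<and>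
     (\<forall>t\<in>teams T. \<forall>g\<in>games T. game_round T g > 1 \<and> B t g = 1 \<longrightarrow>
        B t (predecessor_of T g t) = 1)"

definition score :: "bracket_structure \<Rightarrow> bracket \<Rightarrow> bracket \<Rightarrow> nat" where
  "score T E B = (\<Sum>t\<in>teams T. \<Sum>g\<in>games T. 2 ^ (game_round T g - 1) * E t g * B t g)"

definition max_score :: "bracket_structure \<Rightarrow> bracket set \<Rightarrow> bracket \<Rightarrow> nat" where
  "max_score T Es B = Max ((\<lambda>E. score T E B) ` Es)"

section \<open>The random outcome\<close>

definition win_probabilities :: "bracket_structure \<Rightarrow> (nat \<Rightarrow> nat \<Rightarrow> real) \<Rightarrow> bool" where
  "win_probabilities T P \<longleftrightarrow>
     (\<forall>t\<in>teams T. \<forall>t'\<in>teams T. 0 \<le> P t t' \<and> P t t' \<le> 1) \<and>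
     (\<forall>t\<in>teams T. \<forall>t'\<in>teams T. t \<noteq> t' \<longrightarrow> P t t' + P t' t = 1)"

text \<open>
  The winner of a game between the two elements of \<open>A\<close>. Which of them is called \<open>a\<close> is
  immaterial, because \<open>P a b + P b a = 1\<close>.
\<close>

definition winner_pmf :: "(nat \<Rightarrow> nat \<Rightarrow> real) \<Rightarrow> nat set \<Rightarrow> nat pmf" where
  "winner_pmf P A =
     (let a = Min A; b = Max A
      in map_pmf (\<lambda>a_wins. if a_wins then a else b) (bernoulli_pmf (P a b)))"

definition players :: "bracket_structure \<Rightarrow> (nat \<Rightarrow> nat) \<Rightarrow> nat \<Rightarrow> nat set" where
  "players T w g = (if game_round T g = 1 then game_teams T g else w ` predecessors T g)"

text \<open>
  \<open>winners_pmf T P k\<close> is the joint distribution of the winners of all games of rounds 1 to \<open>k\<close>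
  (games of later rounds are mapped to the dummy value 0). Given the winners of the
  previous rounds, the games of a round are played independently.
\<close>

primrec winners_pmf ::
    "bracket_structure \<Rightarrow> (nat \<Rightarrow> nat \<Rightarrow> real) \<Rightarrow> nat \<Rightarrow> (nat \<Rightarrow> nat) pmf" where
  "winners_pmf T P 0 = return_pmf (\<lambda>_. 0)"
| "winners_pmf T P (Suc k) =
     bind_pmf (winners_pmf T P k) (\<lambda>w.
       map_pmf (\<lambda>v g. if g \<in> round_games T (Suc k) then v g else w g)
         (Pi_pmf (round_games T (Suc k)) 0 (\<lambda>g. winner_pmf P (players T w g))))"

definition outcome_pmf ::
    "bracket_structure \<Rightarrow> (nat \<Rightarrow> nat \<Rightarrow> real) \<Rightarrow> bracket pmf" where
  "outcome_pmf T P =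
     map_pmf (\<lambda>w t g. if t \<in> teams T \<and> g \<in> games T \<and> w g = t then 1 else 0)
       (winners_pmf T P (rounds T))"

definition expected_max_score ::
    "bracket_structure \<Rightarrow> (nat \<Rightarrow> nat \<Rightarrow> real) \<Rightarrow> bracket set \<Rightarrow> real" where
  "expected_max_score T P Es =
     measure_pmf.expectation (outcome_pmf T P) (\<lambda>B. real (max_score T Es B))"

section \<open>Programs on a random-access machine over the reals\<close>

text \<open>
  Exact computation is modelled by while-programs with random-access memory. Memory
  consists of named arrays of natural numbers and named arrays of real numbers; a cell is
  addressed by a list of indices (of length 0 for scalar variables). Every arithmetic operation,
  comparison and memory access takes unit time. Over the naturals there is only addition and
  truncated subtraction, so the unit-cost measure cannot be abused by building huge integers through
  repeated multiplication; over the reals there are the four field operations and comparison, but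
  no rounding. Natural numbers are the only constants.
\<close>

record memory =
  nat_mem :: "string \<Rightarrow> nat list \<Rightarrow> nat"
  real_mem :: "string \<Rightarrow> nat list \<Rightarrow> real"

datatype nexp =
    NConst nat
  | NGet string "nexp list"
  | NAdd nexp nexp
  | NSub nexp nexp

datatype rexp =
    ROfNat nexp
  | RGet string "nexp list"
  | RAdd rexp rexp
  | RSub rexp rexp
  | RMul rexp rexp
  | RDiv rexp rexp

datatype bexp =
    NLess nexp nexp
  | RLess rexp rexp
  | BNot bexp
  | BAnd bexp bexp

datatype com =
    Skip
  | NPut string "nexp list" nexp
  | RPut string "nexp list" rexp
  | Seq com com
  | Cond bexp com com
  | While bexp com

primrec nval :: "memory \<Rightarrow> nexp \<Rightarrow> nat" where
  "nval m (NConst n) = n"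
| "nval m (NGet x is) = nat_mem m x (map (nval m) is)"
| "nval m (NAdd a b) = nval m a + nval m b"
| "nval m (NSub a b) = nval m a - nval m b"

primrec rval :: "memory \<Rightarrow> rexp \<Rightarrow> real" where
  "rval m (ROfNat a) = real (nval m a)"
| "rval m (RGet x is) = real_mem m x (map (nval m) is)"
| "rval m (RAdd a b) = rval m a + rval m b"
| "rval m (RSub a b) = rval m a - rval m b"
| "rval m (RMul a b) = rval m a * rval m b"
| "rval m (RDiv a b) = rval m a / rval m b"

primrec bval :: "memory \<Rightarrow> bexp \<Rightarrow> bool" where
  "bval m (NLess a b) \<longleftrightarrow> nval m a < nval m b"
| "bval m (RLess a b) \<longleftrightarrow> rval m a < rval m b"
| "bval m (BNot a) \<longleftrightarrow> \<not> bval m a"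
| "bval m (BAnd a b) \<longleftrightarrow> bval m a \<and> bval m b"

primrec ncost :: "nexp \<Rightarrow> nat" where
  "ncost (NConst n) = 1"
| "ncost (NGet x is) = 1 + sum_list (map ncost is)"
| "ncost (NAdd a b) = 1 + ncost a + ncost b"
| "ncost (NSub a b) = 1 + ncost a + ncost b"

primrec rcost :: "rexp \<Rightarrow> nat" where
  "rcost (ROfNat a) = 1 + ncost a"
| "rcost (RGet x is) = 1 + sum_list (map ncost is)"
| "rcost (RAdd a b) = 1 + rcost a + rcost b"
| "rcost (RSub a b) = 1 + rcost a + rcost b"
| "rcost (RMul a b) = 1 + rcost a + rcost b"
| "rcost (RDiv a b) = 1 + rcost a + rcost b"

primrec bcost :: "bexp \<Rightarrow> nat" where
  "bcost (NLess a b) = 1 + ncost a + ncost b"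
| "bcost (RLess a b) = 1 + rcost a + rcost b"
| "bcost (BNot a) = 1 + bcost a"
| "bcost (BAnd a b) = 1 + bcost a + bcost b"

definition nat_store :: "string \<Rightarrow> nat list \<Rightarrow> nat \<Rightarrow> memory \<Rightarrow> memory" where
  "nat_store x is v m = m\<lparr>nat_mem := (nat_mem m)(x := (nat_mem m x)(is := v))\<rparr>"

definition real_store :: "string \<Rightarrow> nat list \<Rightarrow> real \<Rightarrow> memory \<Rightarrow> memory" where
  "real_store x is v m = m\<lparr>real_mem := (real_mem m)(x := (real_mem m x)(is := v))\<rparr>"

text \<open>\<open>exec c m n m'\<close>: started in \<open>m\<close>, the program \<open>c\<close> terminates in \<open>m'\<close> after \<open>n\<close> time units.\<close>

inductive exec :: "com \<Rightarrow> memory \<Rightarrow> nat \<Rightarrow> memory \<Rightarrow> bool" where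
  Skip: "exec Skip m 1 m"
| NPut: "exec (NPut x is a) m (1 + sum_list (map ncost is) + ncost a)
           (nat_store x (map (nval m) is) (nval m a) m)"
| RPut: "exec (RPut x is a) m (1 + sum_list (map ncost is) + rcost a)
           (real_store x (map (nval m) is) (rval m a) m)"
| Seq: "exec c m n m' \<Longrightarrow> exec d m' k m'' \<Longrightarrow> exec (Seq c d) m (n + k) m''"
| CondTrue: "bval m b \<Longrightarrow> exec c m n m' \<Longrightarrow> exec (Cond b c d) m (1 + bcost b + n) m'"
| CondFalse: "\<not> bval m b \<Longrightarrow> exec d m n m' \<Longrightarrow> exec (Cond b c d) m (1 + bcost b + n) m'"
| WhileFalse: "\<not> bval m b \<Longrightarrow> exec (While b c) m (1 + bcost b) m"
| WhileTrue: "bval m b \<Longrightarrow> exec c m n m' \<Longrightarrow> exec (While b c) m' k m'' \<Longrightarrow>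
    exec (While b c) m (1 + bcost b + n + k) m''"

inductive_cases SkipE: "exec Skip m n m'"
inductive_cases NPutE: "exec (NPut x is a) m n m'"
inductive_cases RPutE: "exec (RPut x is a) m n m'"
inductive_cases SeqE: "exec (Seq c d) m n m'"
inductive_cases CondE: "exec (Cond b c d) m n m'"
inductive_cases WhileE: "exec (While b c) m n m'"

lemma exec_deterministic:
  "exec c m n m' \<Longrightarrow> exec c m k m'' \<Longrightarrow> n = k \<and> m' = m''"
proof (induction arbitrary: k m'' rule: exec.induct)
  case Skip
  from Skip.prems show ?case by (rule SkipE) simp
next
  case NPut
  from NPut.prems show ?case by (rule NPutE) simp
next
  case RPut
  from RPut.prems show ?case by (rule RPutE) simp
next
  case (Seq c m n m' d l m3)
  from Seq.prems obtain n' l' m1 where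
    k: "k = n' + l'" and 1: "exec c m n' m1" and 2: "exec d m1 l' m''"
    by (rule SeqE)
  from Seq.IH(1)[OF 1] have eq: "n = n'" "m' = m1" by simp_all
  from Seq.IH(2)[of l' m''] 2 show ?case unfolding k eq by simp
next
  case (CondTrue m b c n m' d)
  from CondTrue.prems show ?case
  proof (rule CondE)
    fix n' assume "exec c m n' m''" and k: "k = Suc (bcost b + n')"
    from CondTrue.IH[OF this(1)] show ?thesis unfolding k by simp
  qed (use CondTrue.hyps(1) in simp)
next
  case (CondFalse m b d n m' c)
  from CondFalse.prems show ?case
  proof (rule CondE)
    fix n' assume "exec d m n' m''" and k: "k = Suc (bcost b + n')"
    from CondFalse.IH[OF this(1)] show ?thesis unfolding k by simp
  qed (use CondFalse.hyps(1) in simp)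
next
  case (WhileFalse m b c)
  from WhileFalse.prems show ?case
    by (rule WhileE; use WhileFalse.hyps in simp)
next
  case (WhileTrue m b c n m' l m3)
  from WhileTrue.prems show ?case
  proof (rule WhileE)
    fix n' m1 l'
    assume 1: "exec c m n' m1" and 2: "exec (While b c) m1 l' m''"
      and k: "k = Suc (bcost b + n' + l')"
    from WhileTrue.IH(1)[OF 1] have eq: "n = n'" "m' = m1" by simp_all
    from WhileTrue.IH(2)[of l' m''] 2 show ?thesis unfolding k eq by simp
  qed (use WhileTrue.hyps(1) in simp)
qed

text \<open>
  Only the cells listed below are constrained: the remaining initial contents of the memory are
  arbitrary.
\<close>

definition holds_input ::
    "memory \<Rightarrow> bracket_structure \<Rightarrow> (nat \<Rightarrow> nat \<Rightarrow> real) \<Rightarrow> nat \<Rightarrow> (nat \<Rightarrow> bracket) \<Rightarrow> bool" where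
  "holds_input m T P e E \<longleftrightarrow>
     nat_mem m ''rounds'' [] = rounds T \<and>
     nat_mem m ''teams'' [] = num_teams T \<and>
     nat_mem m ''entries'' [] = e \<and>
     (\<forall>g\<in>games T. nat_mem m ''round'' [g] = game_round T g) \<and>
     (\<forall>g\<in>games T. \<forall>t\<in>teams T.
        nat_mem m ''plays'' [g, t] = (if t \<in> game_teams T g then 1 else 0)) \<and>
     (\<forall>g\<in>games T. \<forall>t\<in>game_teams T g. game_round T g > 1 \<longrightarrow>
        nat_mem m ''pred'' [g, t] = predecessor_of T g t) \<and>
     (\<forall>t\<in>teams T. \<forall>t'\<in>teams T. real_mem m ''P'' [t, t'] = P t t') \<and>
     (\<forall>i\<in>{1..e}. \<forall>t\<in>teams T. \<forall>g\<in>games T. nat_mem m ''E'' [i, t, g] = E i t g)"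

end

(* All score vectors are encoded as numbers below n = b^e with b = t * log2 t, in such a way that
   codes are additive. For a game g of round k, a team u of g and a code c let F(k, u, c) be the
   probability that u wins g and that the games leading up to and including g contribute c to the
   scores. The outcomes in the two halves of the bracket below g are independent, so
     F(k + 1, u, c) = sum over a + d + w = c of F(k, u, a) * (sum over v of P(u, v) * F(k, v, d)),
   where v ranges over the possible opponents of u in g and w encodes the points for a win of u.
   The inner sum does not depend on a, so one pair (g, u) costs O(n^2), and trying all rounds,
   games and teams costs O(log2 t * t * t * n^2) = O(t * b^(2e + 1)). The expected maximum is the
   sum of F(log2 t, u, c) times the largest digit of c. *)
theory Submission
  imports Defs
begin

section \<open>Timed total correctness\<close>

text \<open>The recurrence needs the two halves below a game to be independent, whereas the outcome
  is given as one joint distribution of all winners, generated round by round. The proof therefore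
  carries a product law for all games of a round at once. It survives a round because a game looks
  only at the results of its own two predecessors, and these pairs are disjoint.

  The base is large enough to exclude carries: each of the \<open>log2 t\<close> rounds distributes
  \<open>t / 2\<close> points in total, so even a perfect entry scores only half of
  \<open>b\<close>.

  The naturals of the machine can only be added and subtracted, so powers of \<open>b\<close>,
  points and digits have to be obtained by repeated addition and counting. This is affordable
  because \<open>e\<close>, \<open>b\<close> and \<open>t\<close> are all at most \<open>n\<close>:
  the powers of \<open>b\<close>, the table of digits and, for one pair of a game and a team, the
  sums over opponents for all \<open>d\<close> each fit into \<open>O(n^2)\<close>.\<close>

definition runs :: "com \<Rightarrow> memory \<Rightarrow> nat \<Rightarrow> (memory \<Rightarrow> bool) \<Rightarrow> bool" where
  "runs c m n Q \<longleftrightarrow> (\<exists>k m'. exec c m k m' \<and> k \<le> n \<and> Q m')"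

primrec nat_writes :: "com \<Rightarrow> string set" where
  "nat_writes Skip = {}"
| "nat_writes (NPut x is a) = {x}"
| "nat_writes (RPut x is a) = {}"
| "nat_writes (Seq c d) = nat_writes c \<union> nat_writes d"
| "nat_writes (Cond b c d) = nat_writes c \<union> nat_writes d"
| "nat_writes (While b c) = nat_writes c"

primrec real_writes :: "com \<Rightarrow> string set" where
  "real_writes Skip = {}"
| "real_writes (NPut x is a) = {}"
| "real_writes (RPut x is a) = {x}"
| "real_writes (Seq c d) = real_writes c \<union> real_writes d"
| "real_writes (Cond b c d) = real_writes c \<union> real_writes d"
| "real_writes (While b c) = real_writes c"

lemma nat_mem_store [simp]:
  "nat_mem (nat_store x is a m) y js = (if y = x \<and> js = is then a else nat_mem m y js)"
  "nat_mem (real_store x is r m) = nat_mem m"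
  by (auto simp: nat_store_def real_store_def)

lemma real_mem_store [simp]:
  "real_mem (real_store x is r m) y js = (if y = x \<and> js = is then r else real_mem m y js)"
  "real_mem (nat_store x is a m) = real_mem m"
  by (auto simp: nat_store_def real_store_def)

lemma nat_mem_store_other [simp]: "y \<noteq> x \<Longrightarrow> nat_mem (nat_store x is a m) y = nat_mem m y"
  by (simp add: nat_store_def)

lemma real_mem_store_other [simp]: "y \<noteq> x \<Longrightarrow> real_mem (real_store x is a m) y = real_mem m y"
  by (simp add: real_store_def)

lemma exec_frame:
  "exec c m n m' \<Longrightarrow> (\<forall>x. x \<notin> nat_writes c \<longrightarrow> nat_mem m' x = nat_mem m x) \<and>
     (\<forall>x. x \<notin> real_writes c \<longrightarrow> real_mem m' x = real_mem m x)"
  by (induction rule: exec.induct) (auto simp: nat_store_def real_store_def)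

text \<open>Specifications mention only what a command computes. Everything else is recovered here
  from the names of the arrays that the command can write, which are known syntactically.\<close>

lemma runs_frame:
  assumes "runs c m n Q"
    and "\<And>m'. Q m' \<Longrightarrow> (\<And>x. x \<notin> nat_writes c \<Longrightarrow> nat_mem m' x = nat_mem m x) \<Longrightarrow>
      (\<And>x. x \<notin> real_writes c \<Longrightarrow> real_mem m' x = real_mem m x) \<Longrightarrow> Q' m'"
    and "n \<le> l"
  shows "runs c m l Q'"
proof -
  obtain k m' where k: "exec c m k m'" "k \<le> n" "Q m'"
    using assms(1) by (auto simp: runs_def)
  have "Q' m'"
    using exec_frame[OF k(1)] by (intro assms(2) k(3)) auto
  then show ?thesis
    unfolding runs_def using k assms(3) by (meson order_trans)
qed

lemma runs_weaken: "runs c m n Q \<Longrightarrow> n \<le> l \<Longrightarrow> runs c m l Q"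
  by (rule runs_frame)

lemma runs_NPut:
  "Q (nat_store x (map (nval m) is) (nval m a) m) \<Longrightarrow>
   1 + sum_list (map ncost is) + ncost a \<le> n \<Longrightarrow> runs (NPut x is a) m n Q"
  unfolding runs_def using exec.NPut by blast

lemma runs_RPut:
  "Q (real_store x (map (nval m) is) (rval m a) m) \<Longrightarrow>
   1 + sum_list (map ncost is) + rcost a \<le> n \<Longrightarrow> runs (RPut x is a) m n Q"
  unfolding runs_def using exec.RPut by blast

lemma runs_Seq:
  assumes "runs c m n (\<lambda>m'. runs d m' k Q)" and "n + k \<le> l"
  shows "runs (Seq c d) m l Q"
  using assms unfolding runs_def by (meson Seq add_mono order_trans)

lemma runs_Cond:
  assumes "bval m b \<Longrightarrow> runs c m n Q" and "\<not> bval m b \<Longrightarrow> runs d m n Q"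
    and "1 + bcost b + n \<le> l"
  shows "runs (Cond b c d) m l Q"
proof (cases "bval m b")
  case True
  from assms(1)[OF this] obtain k m' where "exec c m k m'" "k \<le> n" "Q m'"
    by (auto simp: runs_def)
  with exec.CondTrue[OF True this(1)] assms(3) show ?thesis
    unfolding runs_def by (metis add_left_mono order_trans)
next
  case False
  from assms(2)[OF this] obtain k m' where "exec d m k m'" "k \<le> n" "Q m'"
    by (auto simp: runs_def)
  with exec.CondFalse[OF False this(1)] assms(3) show ?thesis
    unfolding runs_def by (metis add_left_mono order_trans)
qed

text \<open>Determinism turns the rules for loop-free code into equivalences. With them the
  simplifier executes such code symbolically and subtracts each cost from the remaining
  budget.\<close>

lemma runs_exec_iff: "exec c m k m' \<Longrightarrow> runs c m n Q \<longleftrightarrow> k \<le> n \<and> Q m'"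
  unfolding runs_def using exec_deterministic by blast

lemma runs_loop_free:
  "runs Skip m n Q \<longleftrightarrow> 1 \<le> n \<and> Q m"
  "runs (NPut x is a) m n Q \<longleftrightarrow> 1 + sum_list (map ncost is) + ncost a \<le> n \<and>
     Q (nat_store x (map (nval m) is) (nval m a) m)"
  "runs (RPut x is r) m n Q \<longleftrightarrow> 1 + sum_list (map ncost is) + rcost r \<le> n \<and>
     Q (real_store x (map (nval m) is) (rval m r) m)"
  "runs (Cond b c d) m n Q \<longleftrightarrow> 1 + bcost b \<le> n \<and>
     (if bval m b then runs c m (n - (1 + bcost b)) Q else runs d m (n - (1 + bcost b)) Q)"
proof -
  show "runs Skip m n Q \<longleftrightarrow> 1 \<le> n \<and> Q m"
    by (rule runs_exec_iff[OF exec.Skip])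
  show "runs (NPut x is a) m n Q \<longleftrightarrow> 1 + sum_list (map ncost is) + ncost a \<le> n \<and>
     Q (nat_store x (map (nval m) is) (nval m a) m)"
    by (rule runs_exec_iff[OF exec.NPut])
  show "runs (RPut x is r) m n Q \<longleftrightarrow> 1 + sum_list (map ncost is) + rcost r \<le> n \<and>
     Q (real_store x (map (nval m) is) (rval m r) m)"
    by (rule runs_exec_iff[OF exec.RPut])
  show "runs (Cond b c d) m n Q \<longleftrightarrow> 1 + bcost b \<le> n \<and>
     (if bval m b then runs c m (n - (1 + bcost b)) Q else runs d m (n - (1 + bcost b)) Q)"
    (is "?l \<longleftrightarrow> ?r")
  proof
    assume ?l
    then obtain k m' where "exec (Cond b c d) m k m'" "k \<le> n" "Q m'" by (auto simp: runs_def)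
    then show ?r
      by (cases rule: CondE[OF \<open>exec (Cond b c d) m k m'\<close>]) (fastforce simp: runs_def)+
  next
    assume ?r
    then show ?l by (intro runs_Cond[where n = "n - (1 + bcost b)"]) auto
  qed
qed

lemma runs_Seq_put:
  "runs (Seq (NPut x is a) d) m n Q \<longleftrightarrow> 1 + sum_list (map ncost is) + ncost a \<le> n \<and>
     runs d (nat_store x (map (nval m) is) (nval m a) m) (n - (1 + sum_list (map ncost is) + ncost a)) Q"
  "runs (Seq (RPut x is r) d) m n Q \<longleftrightarrow> 1 + sum_list (map ncost is) + rcost r \<le> n \<and>
     runs d (real_store x (map (nval m) is) (rval m r) m) (n - (1 + sum_list (map ncost is) + rcost r)) Q"
proof -
  have *: "runs (Seq c d) m n Q \<longleftrightarrow> k \<le> n \<and> runs d m' (n - k) Q" if c: "exec c m k m'" for c k m'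
  proof
    assume "runs (Seq c d) m n Q"
    then obtain l m1 where l: "exec (Seq c d) m l m1" "l \<le> n" "Q m1" by (auto simp: runs_def)
    from l(1) obtain k1 k2 m2 where "l = k1 + k2" "exec c m k1 m2" "exec d m2 k2 m1" by (rule SeqE)
    with exec_deterministic[OF c this(2)] l show "k \<le> n \<and> runs d m' (n - k) Q"
      unfolding runs_def by (auto intro!: exI[of _ k2] exI[of _ m1])
  next
    assume "k \<le> n \<and> runs d m' (n - k) Q"
    with c show "runs (Seq c d) m n Q"
      by (intro runs_Seq[where n = k and k = "n - k"]) (auto simp: runs_def)
  qed
  show "runs (Seq (NPut x is a) d) m n Q \<longleftrightarrow> 1 + sum_list (map ncost is) + ncost a \<le> n \<and>
     runs d (nat_store x (map (nval m) is) (nval m a) m) (n - (1 + sum_list (map ncost is) + ncost a)) Q"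
    by (rule *[OF exec.NPut])
  show "runs (Seq (RPut x is r) d) m n Q \<longleftrightarrow> 1 + sum_list (map ncost is) + rcost r \<le> n \<and>
     runs d (real_store x (map (nval m) is) (rval m r) m) (n - (1 + sum_list (map ncost is) + rcost r)) Q"
    by (rule *[OF exec.RPut])
qed

lemmas runs_simps = runs_loop_free runs_Seq_put

section \<open>Counting loops and their cost\<close>

definition For :: "string \<Rightarrow> nat \<Rightarrow> nexp \<Rightarrow> com \<Rightarrow> com" where
  "For v lo hi c = Seq (NPut v [] (NConst lo))
     (While (NLess (NGet v []) hi) (Seq c (NPut v [] (NAdd (NGet v []) (NConst 1)))))"

lemma writes_For [simp]:
  "nat_writes (For v lo hi c) = insert v (nat_writes c)"
  "real_writes (For v lo hi c) = real_writes c"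
  by (auto simp: For_def)

text \<open>The invariant must be insensitive to the counter cell, so that neither the
  initialisation nor the increment can break it; the value of the counter is handed to the body
  separately. One round costs \<open>n\<close> for the body, \<open>ncost hi + 3\<close> for the
  test and 4 for the increment. The last summand pays for the initialisation and the final
  test.\<close>

lemma runs_For:
  assumes bound: "\<And>m'. (\<And>x. x \<notin> insert v (nat_writes c) \<Longrightarrow> nat_mem m' x = nat_mem m x) \<Longrightarrow> nval m' hi = h"
    and v: "v \<notin> nat_writes c" and lo: "lo \<le> h"
    and store: "\<And>j a m'. I j m' \<Longrightarrow> I j (nat_store v [] a m')"
    and init: "I lo m"
    and step: "\<And>j m'. lo \<le> j \<Longrightarrow> j < h \<Longrightarrow> I j m' \<Longrightarrow> nat_mem m' v [] = j \<Longrightarrow>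
      (\<And>x. x \<notin> insert v (nat_writes c) \<Longrightarrow> nat_mem m' x = nat_mem m x) \<Longrightarrow>
      (\<And>x. x \<notin> real_writes c \<Longrightarrow> real_mem m' x = real_mem m x) \<Longrightarrow>
      runs c m' n (I (Suc j))"
    and cost: "(h - lo) * (n + ncost hi + 7) + ncost hi + 7 \<le> l"
    and exit: "\<And>m'. I h m' \<Longrightarrow>
      (\<And>x. x \<notin> insert v (nat_writes c) \<Longrightarrow> nat_mem m' x = nat_mem m x) \<Longrightarrow>
      (\<And>x. x \<notin> real_writes c \<Longrightarrow> real_mem m' x = real_mem m x) \<Longrightarrow> Q m'"
  shows "runs (For v lo hi c) m l Q"
proof -
  define fr :: "memory \<Rightarrow> bool" where "fr m' \<longleftrightarrow> (\<forall>x. x \<notin> insert v (nat_writes c) \<longrightarrow> nat_mem m' x = nat_mem m x) \<and>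
     (\<forall>x. x \<notin> real_writes c \<longrightarrow> real_mem m' x = real_mem m x)" for m'
  define w where "w = While (NLess (NGet v []) hi) (Seq c (NPut v [] (NAdd (NGet v []) (NConst 1))))"
  have fr_store: "fr (nat_store v [] a m')" if "fr m'" for a m'
    using that by (auto simp: fr_def nat_store_def)
  have hi: "nval m' hi = h" if "fr m'" for m'
    using that by (intro bound) (auto simp: fr_def)
  have loop: "runs w m' ((h - j) * (n + ncost hi + 7) + ncost hi + 3) (\<lambda>m'. I h m' \<and> fr m')"
    if "lo \<le> j" "j \<le> h" "I j m'" "nat_mem m' v [] = j" "fr m'" for j m'
    using that
  proof (induction "h - j" arbitrary: j m')
    case 0
    then have j: "j = h" by simp
    have "exec w m' (1 + bcost (NLess (NGet v []) hi)) m'"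
      unfolding w_def by (rule exec.WhileFalse) (use 0 j hi in auto)
    with 0 j show ?case
      unfolding runs_def by (intro exI[of _ "1 + bcost (NLess (NGet v []) hi)"] exI[of _ m']) auto
  next
    case (Suc d)
    then have j: "j < h" by simp
    have "runs c m' n (I (Suc j))"
      using Suc.prems j by (intro step) (auto simp: fr_def)
    then obtain k m1 where k: "exec c m' k m1" "k \<le> n" "I (Suc j) m1"
      by (auto simp: runs_def)
    have fr1: "fr m1"
      using exec_frame[OF k(1)] \<open>fr m'\<close> by (auto simp: fr_def)
    have m1v: "nat_mem m1 v [] = j"
      using exec_frame[OF k(1)] v Suc.prems by auto
    define m2 where "m2 = nat_store v [] (Suc j) m1"
    have body: "exec (Seq c (NPut v [] (NAdd (NGet v []) (NConst 1)))) m' (k + 4) m2"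
      using exec.Seq[OF k(1) exec.NPut[of v "[]" "NAdd (NGet v []) (NConst 1)" m1]] m1v
      by (simp add: m2_def eval_nat_numeral)
    have "runs w m2 ((h - Suc j) * (n + ncost hi + 7) + ncost hi + 3) (\<lambda>m'. I h m' \<and> fr m')"
      by (rule Suc.hyps(1)) (use Suc j k fr1 store fr_store in \<open>auto simp: m2_def\<close>)
    then obtain k' m3 where k': "exec w m2 k' m3"
      "k' \<le> (h - Suc j) * (n + ncost hi + 7) + ncost hi + 3" "I h m3" "fr m3"
      by (auto simp: runs_def)
    have ex: "exec w m' (1 + bcost (NLess (NGet v []) hi) + (k + 4) + k') m3"
      unfolding w_def
      by (rule exec.WhileTrue[OF _ body]) (use Suc j hi k'(1) in \<open>auto simp: w_def\<close>)
    have "h - j = Suc (h - Suc j)" using j by simp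
    then have "1 + bcost (NLess (NGet v []) hi) + (k + 4) + k'
        \<le> (h - j) * (n + ncost hi + 7) + ncost hi + 3"
      using k(2) k'(2) by (simp add: algebra_simps)
    with ex k' show ?case unfolding runs_def by blast
  qed
  have "fr m" by (simp add: fr_def)
  then have "runs w (nat_store v [] lo m) ((h - lo) * (n + ncost hi + 7) + ncost hi + 3) (\<lambda>m'. I h m' \<and> fr m')"
    by (intro loop) (use lo store init fr_store in auto)
  then have "runs w (nat_store v [] lo m) ((h - lo) * (n + ncost hi + 7) + ncost hi + 3) Q"
    unfolding runs_def using exit by (metis fr_def)
  then show ?thesis
    unfolding For_def w_def[symmetric]
    by (intro runs_Seq[OF runs_NPut[where n = 2]]) (use cost in auto)
qed

definition eq_exp :: "nexp \<Rightarrow> nexp \<Rightarrow> bexp" where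
  "eq_exp a b = BAnd (BNot (NLess a b)) (BNot (NLess b a))"

definition or_exp :: "bexp \<Rightarrow> bexp \<Rightarrow> bexp" where
  "or_exp a b = BNot (BAnd (BNot a) (BNot b))"

lemma val_eq_or [simp]:
  "bval m (eq_exp a b) \<longleftrightarrow> nval m a = nval m b"
  "bval m (or_exp p q) \<longleftrightarrow> bval m p \<or> bval m q"
  by (auto simp: eq_exp_def or_exp_def)

lemma cost_eq_or [simp]:
  "bcost (eq_exp a b) = 5 + 2 * (ncost a + ncost b)"
  "bcost (or_exp p q) = 4 + bcost p + bcost q"
  by (auto simp: eq_exp_def or_exp_def)

text \<open>Since \<open>M\<close> and \<open>h\<close> are at least 1, all overhead of a loop can
  be charged to the main term. In nested loops only the constant grows.\<close>

lemma loop_cost: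
  fixes h :: nat
  assumes "n \<le> K * M" "1 \<le> M" "1 \<le> h"
  shows "(h - lo) * (n + x + 7) + x + 7 \<le> (K + 2 * x + 14) * (h * M)"
proof -
  have "x + 7 \<le> (x + 7) * M" using assms by (simp del: distrib_right_numeral)
  with assms(1) have "n + x + 7 \<le> K * M + (x + 7) * M" unfolding add.assoc by (rule add_mono)
  then have "(h - lo) * (n + x + 7) \<le> h * (K * M + (x + 7) * M)" by (intro mult_le_mono) auto
  moreover have "(x + 7) * 1 \<le> (x + 7) * (h * M)"
    using assms by (intro mult_le_mono) auto
  ultimately show ?thesis by (simp add: algebra_simps)
qed

section \<open>Probability mass functions\<close>

text \<open>Kernels that read disjoint blocks of independent data produce independent results. The
  induction splits the block of one index off the product; by the locality assumption the other
  kernels see only the rest. This is what carries independence from one round of the tournament to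
  the next.\<close>

lemma Pi_pmf_bind_disjoint:
  assumes "finite I" "finite A" "\<And>i. i \<in> I \<Longrightarrow> N i \<subseteq> A" "disjoint_family_on N I"
    and "\<And>i s s'. i \<in> I \<Longrightarrow> (\<And>x. x \<in> N i \<Longrightarrow> s x = s' x) \<Longrightarrow> K i s = K i s'"
  shows "bind_pmf (Pi_pmf A d p) (\<lambda>s. Pi_pmf I d' (\<lambda>i. K i s)) =
    Pi_pmf I d' (\<lambda>i. bind_pmf (Pi_pmf (N i) d p) (K i))"
  using assms
proof (induction I arbitrary: A rule: finite_induct)
  case empty
  then show ?case by simp
next
  case (insert i I)
  let ?B = "A - N i"
  let ?mix = "\<lambda>f g x. if x \<in> N i then f x else g x"
  have fin: "finite (N i)" "finite ?B"
    using insert.prems by (auto intro: finite_subset)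
  have A: "A = N i \<union> ?B" using insert.prems(2)[of i] by auto
  have disj: "N j \<inter> N i = {}" if "j \<in> I" for j
    using disjoint_family_onD[OF insert.prems(3), of j i] insert.hyps that by auto
  have union: "Pi_pmf A d p = bind_pmf (Pi_pmf (N i) d p) (\<lambda>f. bind_pmf (Pi_pmf ?B d p) (\<lambda>g. return_pmf (?mix f g)))"
  proof -
    have "N i \<inter> ?B = {}" by blast
    from Pi_pmf_union[OF fin this, of d p] show ?thesis
      unfolding A[symmetric]
      by (simp only: map_pmf_def pair_pmf_def bind_assoc_pmf bind_return_pmf case_prod_conv)
  qed
  have Ki: "K i (?mix f g) = K i f" for f g
    by (rule insert.prems(4)) auto
  have Kj: "Pi_pmf I d' (\<lambda>j. K j (?mix f g)) = Pi_pmf I d' (\<lambda>j. K j g)" for f g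
  proof (intro Pi_pmf_cong refl insert.prems(4))
    show "j \<in> insert i I" if "j \<in> I" for j using that by simp
    show "?mix f g x = g x" if "j \<in> I" "x \<in> N j" for j x using that disj[of j] by auto
  qed
  have IH: "bind_pmf (Pi_pmf ?B d p) (\<lambda>s. Pi_pmf I d' (\<lambda>j. K j s)) =
      Pi_pmf I d' (\<lambda>j. bind_pmf (Pi_pmf (N j) d p) (K j))"
  proof (rule insert.IH)
    show "N j \<subseteq> ?B" if "j \<in> I" for j using insert.prems(2)[of j] disj[OF that] that by auto
    show "disjoint_family_on N I"
      using insert.prems(3) by (simp add: disjoint_family_on_def)
    show "K j s = K j s'" if "j \<in> I" "\<And>x. x \<in> N j \<Longrightarrow> s x = s' x" for j s s'
      using that by (intro insert.prems(4)) auto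
  qed (rule fin)
  have "bind_pmf (Pi_pmf A d p) (\<lambda>s. Pi_pmf (insert i I) d' (\<lambda>j. K j s)) =
      bind_pmf (Pi_pmf (N i) d p) (\<lambda>f. bind_pmf (Pi_pmf ?B d p) (\<lambda>g. bind_pmf (K i f) (\<lambda>y.
          bind_pmf (Pi_pmf I d' (\<lambda>j. K j g)) (\<lambda>h. return_pmf (h(i := y))))))"
    unfolding union Pi_pmf_insert'[OF insert.hyps]
    by (simp add: bind_assoc_pmf bind_return_pmf Ki Kj)
  \<comment> \<open>\<open>K i f\<close> does not involve \<open>g\<close>, so the remaining data
    can be drawn after it; then the two groups of draws separate.\<close>
  also have "\<dots> = bind_pmf (Pi_pmf (N i) d p) (\<lambda>f. bind_pmf (K i f) (\<lambda>y. bind_pmf (Pi_pmf ?B d p) (\<lambda>g.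
          bind_pmf (Pi_pmf I d' (\<lambda>j. K j g)) (\<lambda>h. return_pmf (h(i := y))))))"
    by (intro bind_pmf_cong refl bind_commute_pmf)
  also have "\<dots> = bind_pmf (bind_pmf (Pi_pmf (N i) d p) (K i)) (\<lambda>y.
          bind_pmf (bind_pmf (Pi_pmf ?B d p) (\<lambda>g. Pi_pmf I d' (\<lambda>j. K j g))) (\<lambda>h. return_pmf (h(i := y))))"
    by (simp add: bind_assoc_pmf)
  also have "\<dots> = Pi_pmf (insert i I) d' (\<lambda>j. bind_pmf (Pi_pmf (N j) d p) (K j))"
    unfolding IH Pi_pmf_insert'[OF insert.hyps] ..
  finally show ?case .
qed

text \<open>The guard fixes the value outside \<open>A\<close>, so nothing has to relate
  \<open>f x d\<close> to \<open>d'\<close>, and each factor may be mapped by its own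
  function.\<close>

lemma map_Pi_pmf_dependent:
  assumes "finite A"
  shows "map_pmf (\<lambda>v x. if x \<in> A then f x (v x) else d') (Pi_pmf A d p) =
    Pi_pmf A d' (\<lambda>x. map_pmf (f x) (p x))"
  using assms by (simp add: map_pmf_def Pi_pmf_bind[where d' = d])

lemma pmf_bind_finite:
  assumes "finite S" "set_pmf M \<subseteq> S"
  shows "pmf (bind_pmf M f) i = (\<Sum>s\<in>S. pmf M s * pmf (f s) i)"
  unfolding pmf_bind using assms by (subst integral_measure_pmf_real[of S]) (auto simp: mult.commute)

lemma pmf_map_graph: "pmf (map_pmf (\<lambda>u. (u, m u)) W) (u, c) = (if m u = c then pmf W u else 0)"
proof -
  have "(\<lambda>u. (u, m u)) -` {(u, c)} = (if m u = c then {u} else {})" by auto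
  then show ?thesis by (simp add: pmf_map measure_pmf_single)
qed

lemma set_winner_pmf: "set_pmf (winner_pmf P {x, y}) \<subseteq> {x, y :: nat}"
  by (auto simp: winner_pmf_def Let_def min_def max_def)

text \<open>If \<open>x\<close> is the larger number, the coin is thrown for \<open>y\<close>, and
  \<open>x\<close> wins with probability \<open>1 - P y x\<close>; complementarity makes both orders
  agree.\<close>

lemma pmf_winner_pmf:
  assumes "x \<noteq> y" "0 \<le> P x y" "P x y \<le> 1" "0 \<le> P y x" "P x y + P y x = 1"
  shows "pmf (winner_pmf P {x, y}) x = P x y"
proof -
  have *: "pmf (map_pmf (\<lambda>w. if w then a else b) (bernoulli_pmf p)) x =
      (if x = a then p else if x = b then 1 - p else 0)"
    if "a \<noteq> b" "0 \<le> p" "p \<le> 1" for a b :: nat and p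
  proof -
    have "(\<lambda>w. if w then a else b) -` {x} = (if x = a then {True} else if x = b then {False} else {})"
      using that by (auto split: if_splits)
    then show ?thesis using that by (simp add: pmf_map measure_pmf_single)
  qed
  show ?thesis
    using assms by (cases "x < y") (auto simp: winner_pmf_def Let_def * min_def max_def)
qed

section \<open>The largest digit of a number\<close>

fun max_digit :: "nat \<Rightarrow> nat \<Rightarrow> nat" where
  "max_digit b c = (if c = 0 \<or> b < 2 then 0 else max (c mod b) (max_digit b (c div b)))"

declare max_digit.simps [simp del]

lemma max_digit_rec: "b \<ge> 2 \<Longrightarrow> max_digit b c = max (c mod b) (max_digit b (c div b))"
  by (cases "c = 0") (simp_all add: max_digit.simps[of b c] max_digit.simps[of b 0])

text \<open>As all digits are below \<open>b\<close>, reduction modulo \<open>b\<close> yields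
  \<open>s 0\<close>, and division by \<open>b\<close> shifts the digit sequence by one. The
  inserted 0 covers the empty sequence.\<close>

lemma max_digit_sum:
  assumes "b \<ge> 2" "\<And>i. i < e \<Longrightarrow> s i < b"
  shows "max_digit b (\<Sum>i<e. s i * b ^ i) = Max (insert 0 (s ` {..<e}))"
  using assms(2)
proof (induction e arbitrary: s)
  case 0
  then show ?case by (simp add: max_digit.simps)
next
  case (Suc e)
  let ?t = "\<Sum>i<e. s (Suc i) * b ^ i"
  have sum: "(\<Sum>i<Suc e. s i * b ^ i) = s 0 + b * ?t"
    by (subst sum.lessThan_Suc_shift) (simp add: sum_distrib_left algebra_simps)
  have "s 0 < b" using Suc.prems by simp
  then have "max_digit b (s 0 + b * ?t) = max (s 0) (max_digit b ?t)"
    by (subst max_digit_rec[OF assms(1)]) simp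
  also have "max_digit b ?t = Max (insert 0 ((\<lambda>i. s (Suc i)) ` {..<e}))"
    by (rule Suc.IH) (use Suc.prems in auto)
  also have "max (s 0) \<dots> = Max (insert (s 0) (insert 0 ((\<lambda>i. s (Suc i)) ` {..<e})))"
    by simp
  also have "insert (s 0) (insert 0 ((\<lambda>i. s (Suc i)) ` {..<e})) = insert 0 (s ` {..<Suc e})"
    by (auto simp: lessThan_Suc_eq_insert_0 image_image)
  finally show ?case using sum by simp
qed

section \<open>The distribution of winners and scores\<close>

locale bracket_pool =
  fixes T :: bracket_structure and P :: "nat \<Rightarrow> nat \<Rightarrow> real" and e :: nat and E :: "nat \<Rightarrow> bracket"
  assumes tour: "tournament T"
    and rounds_pos: "rounds T \<ge> 1"
    and probs: "win_probabilities T P"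
    and entries_pos: "e \<ge> 1"
    and feasible: "\<And>i. i \<in> {1..e} \<Longrightarrow> feasible_bracket T (E i)"
begin

text \<open>
  Level 0 consists of the teams, regarded as the winners of games of a fictitious round 0, so that
  the first round needs no special treatment.
\<close>

definition level :: "nat \<Rightarrow> nat set" where
  "level k = (if k = 0 then teams T else round_games T k)"

definition feeders :: "nat \<Rightarrow> nat set" where
  "feeders g = (if game_round T g = 1 then game_teams T g else predecessors T g)"

definition contestants :: "nat \<Rightarrow> nat \<Rightarrow> nat set" where
  "contestants k h = (if k = 0 then {h} else game_teams T h)"

text \<open>
  A score vector is encoded as one number in base \<^term>\<open>num_teams T * rounds T\<close>. No score
  reaches this base, so codes are added without carries. The base is exactly the factor
  \<open>t log t\<close> of the time bound.
\<close>

definition base :: nat where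
  "base = num_teams T * rounds T"

text \<open>Entries are numbered from 1 but digit positions from 0, hence
  \<open>Suc i\<close>.\<close>

definition points :: "nat \<Rightarrow> nat \<Rightarrow> nat" where
  "points g u = (\<Sum>i<e. 2 ^ (game_round T g - 1) * E (Suc i) u g * base ^ i)"

text \<open>The winner of a game, together with the code of the scores collected in its part of the bracket.\<close>

primrec result :: "(nat \<Rightarrow> nat) \<Rightarrow> nat \<Rightarrow> nat \<Rightarrow> nat \<times> nat" where
  "result w 0 h = (h, 0)"
| "result w (Suc k) g = (w g, (\<Sum>h\<in>feeders g. snd (result w k h)) + points g (w g))"

text \<open>One game as a kernel from the results of its feeders. It takes a whole assignment
  \<open>s\<close> of results, which is the shape that \<open>Pi_pmf_bind_disjoint\<close>
  expects.\<close>

definition play :: "nat \<Rightarrow> (nat \<Rightarrow> nat \<times> nat) \<Rightarrow> (nat \<times> nat) pmf" where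
  "play g s = map_pmf (\<lambda>u. (u, (\<Sum>h\<in>feeders g. snd (s h)) + points g u))
     (winner_pmf P (fst ` s ` feeders g))"

text \<open>Independence of the feeders is built into this recursion; that the tournament really
  follows it is the content of \<open>map_winners_pmf\<close>.\<close>

primrec law :: "nat \<Rightarrow> nat \<Rightarrow> (nat \<times> nat) pmf" where
  "law 0 h = return_pmf (h, 0)"
| "law (Suc k) g = bind_pmf (Pi_pmf (feeders g) (0, 0) (law k)) (play g)"

section \<open>Combinatorics of the bracket\<close>

lemma game_round_range: "g \<in> games T \<Longrightarrow> game_round T g \<in> {1..rounds T}"
  using tour unfolding tournament_def by blast

lemma predecessors:
  assumes "g \<in> games T" "game_round T g > 1"
  shows "predecessors T g \<subseteq> round_games T (game_round T g - 1)"
    and "card (predecessors T g) = 2"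
    and "game_teams T g = (\<Union>h\<in>predecessors T g. game_teams T h)"
proof -
  from tour have "\<forall>g\<in>games T. game_round T g > 1 \<longrightarrow>
        predecessors T g \<subseteq> round_games T (game_round T g - 1) \<and>
        card (predecessors T g) = 2 \<and>
        game_teams T g = (\<Union>h\<in>predecessors T g. game_teams T h)"
    unfolding tournament_def by (elim conjE)
  with assms show "predecessors T g \<subseteq> round_games T (game_round T g - 1)"
    "card (predecessors T g) = 2"
    "game_teams T g = (\<Union>h\<in>predecessors T g. game_teams T h)"
    by blast+
qed

lemma first_round:
  "g \<in> round_games T 1 \<Longrightarrow> card (game_teams T g) = 2"
  "disjoint_family_on (game_teams T) (round_games T 1)"
  "(\<Union>g\<in>round_games T 1. game_teams T g) = teams T"
  using tour rounds_pos unfolding tournament_def by blast+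

lemma finite_level [simp]: "finite (level k)"
  by (simp add: level_def teams_def round_games_def games_def)

lemma level_Suc: "g \<in> level (Suc k) \<longleftrightarrow> g \<in> games T \<and> game_round T g = Suc k"
  by (simp add: level_def round_games_def)

lemma contestants_Suc [simp]: "contestants (Suc k) g = game_teams T g"
  by (simp add: contestants_def)

lemma level_range: "k > rounds T \<Longrightarrow> level k = {}"
  using game_round_range by (fastforce simp: level_def round_games_def)

lemma card_level:
  assumes "k \<le> rounds T" shows "card (level k) = 2 ^ (rounds T - k)"
proof -
  have "\<forall>k\<in>{1..rounds T}. card (round_games T k) = num_teams T div 2 ^ k"
    using tour unfolding tournament_def by blast
  then have "card (level k) = 2 ^ rounds T div 2 ^ k"
    using assms by (simp add: level_def teams_def num_teams_def)
  with assms show ?thesis by (simp add: power_diff)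
qed

lemma feeders_0: "g \<in> level (Suc 0) \<Longrightarrow> feeders g = game_teams T g"
  by (simp add: feeders_def level_Suc)

lemma feeders_Suc: "g \<in> level (Suc k) \<Longrightarrow> k \<noteq> 0 \<Longrightarrow> feeders g = predecessors T g"
  by (simp add: feeders_def level_Suc)

lemma feeders_subset:
  assumes "g \<in> level (Suc k)" shows "feeders g \<subseteq> level k"
proof (cases "k = 0")
  case True
  then show ?thesis
    using assms first_round(3) feeders_0 by (auto simp: level_def)
next
  case False
  then show ?thesis
    using assms predecessors(1)[of g] feeders_Suc[OF assms False] by (simp add: level_Suc) (simp add: level_def)
qed

lemma card_feeders:
  assumes "g \<in> level (Suc k)" shows "card (feeders g) = 2"
proof (cases "k = 0")
  case True
  then show ?thesis
    using assms first_round(1)[of g] feeders_0[of g] by (simp add: level_def)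
next
  case False
  then show ?thesis
    using assms predecessors(2)[of g] feeders_Suc[OF assms False] by (simp add: level_Suc)
qed

lemma finite_feeders: "g \<in> level (Suc k) \<Longrightarrow> finite (feeders g)"
  using card_feeders card.infinite by fastforce

lemma feedersE:
  assumes "g \<in> level (Suc k)"
  obtains h h' where "feeders g = {h, h'}" "h \<noteq> h'"
  using card_feeders[OF assms] by (auto simp: card_2_iff)

lemma disjoint_feeders: "disjoint_family_on feeders (level (Suc k))"
proof (cases "k = 0")
  case True
  then have "disjoint_family_on (game_teams T) (level (Suc k))"
    using first_round(2) by (simp add: level_def)
  with True show ?thesis by (simp add: disjoint_family_on_def feeders_0)
next
  case False
  have "disjoint_family_on (predecessors T) {g \<in> games T. game_round T g > 1}"
    using tour unfolding tournament_def by (elim conjE)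
  with False show ?thesis by (simp add: disjoint_family_on_def feeders_Suc) (simp add: level_Suc)
qed

lemma game_teams_feeders:
  assumes "g \<in> level (Suc k)"
  shows "game_teams T g = (\<Union>h\<in>feeders g. contestants k h)"
proof (cases "k = 0")
  case True
  then show ?thesis using assms by (simp add: feeders_0 contestants_def)
next
  case False
  then show ?thesis
    using assms predecessors(3)[of g] feeders_Suc[OF assms False] by (simp add: contestants_def level_Suc)
qed

text \<open>Disjointness climbs the bracket: different games of a level have disjoint sets of
  feeders, and different feeders have disjoint team sets by induction. Uniqueness of
  \<open>predecessor_of\<close> and of a team's game in a round both rest on this.\<close>

lemma disjoint_contestants: "disjoint_family_on (contestants k) (level k)"
proof (induction k)
  case 0
  then show ?case by (auto simp: disjoint_family_on_def contestants_def)
next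
  case (Suc k)
  have "contestants k h \<inter> contestants k h' = {}"
    if "g \<in> level (Suc k)" "g' \<in> level (Suc k)" "g \<noteq> g'" "h \<in> feeders g" "h' \<in> feeders g'"
    for g g' h h'
  proof -
    have "h \<noteq> h'" using disjoint_family_onD[OF disjoint_feeders that(1-3)] that(4,5) by auto
    moreover have "h \<in> level k" "h' \<in> level k" using feeders_subset that by auto
    ultimately show ?thesis by (intro disjoint_family_onD[OF Suc.IH])
  qed
  then show ?case
    by (simp add: disjoint_family_on_def game_teams_feeders) blast
qed

text \<open>A counting argument: the feeders form \<open>2 ^ (rounds T - Suc k)\<close> disjoint
  pairs inside a level of \<open>2 ^ (rounds T - k)\<close> elements, so none is left over. Thus
  every winner advances, although \<open>tournament\<close> only demands disjointness.\<close>

lemma Union_feeders: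
  assumes "k < rounds T" shows "(\<Union>g\<in>level (Suc k). feeders g) = level k"
proof (rule card_subset_eq)
  show "(\<Union>g\<in>level (Suc k). feeders g) \<subseteq> level k" using feeders_subset by auto
  have "card (\<Union>g\<in>level (Suc k). feeders g) = (\<Sum>g\<in>level (Suc k). card (feeders g))"
    using disjoint_feeders[of k] finite_feeders
    by (intro card_UN_disjoint) (auto simp: disjoint_family_on_def)
  also have "\<dots> = 2 ^ Suc (rounds T - Suc k)"
    using assms by (simp add: card_feeders card_level)
  also have "\<dots> = card (level k)"
    using assms by (simp add: card_level Suc_diff_Suc del: power_Suc)
  finally show "card (\<Union>g\<in>level (Suc k). feeders g) = card (level k)" .
qed simp

lemma Union_contestants:
  assumes "k \<le> rounds T" shows "(\<Union>h\<in>level k. contestants k h) = teams T"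
  using assms
proof (induction k)
  case 0
  then show ?case by (auto simp: level_def contestants_def)
next
  case (Suc k)
  have "(\<Union>g\<in>level (Suc k). contestants (Suc k) g) = (\<Union>h\<in>(\<Union>g\<in>level (Suc k). feeders g). contestants k h)"
    by (simp add: game_teams_feeders)
  also have "\<dots> = teams T"
    using Union_feeders[of k] Suc by simp
  finally show ?case .
qed

lemma contestants_teams: "h \<in> level k \<Longrightarrow> contestants k h \<subseteq> teams T"
  using Union_contestants[of k] level_range[of k] by (cases "k \<le> rounds T") auto

lemma finite_contestants: "h \<in> level k \<Longrightarrow> finite (contestants k h)"
  using contestants_teams[of h k] finite_subset by (fastforce simp: teams_def)

lemma predecessor_of_eq:
  assumes "g \<in> level (Suc k)" "k \<noteq> 0" "h \<in> feeders g" "u \<in> contestants k h"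
  shows "predecessor_of T g u = h"
proof -
  have pred: "predecessors T g = feeders g" and cont: "contestants k x = game_teams T x" for x
    using assms(1,2) by (simp_all add: feeders_Suc contestants_def)
  show ?thesis
    unfolding predecessor_of_def
  proof (rule the_equality)
    show "h \<in> predecessors T g \<and> u \<in> game_teams T h"
      using assms(3,4) by (simp add: pred cont)
    fix h' assume "h' \<in> predecessors T g \<and> u \<in> game_teams T h'"
    then have h': "h' \<in> feeders g" "u \<in> contestants k h'" by (simp_all add: pred cont)
    show "h' = h"
    proof (rule ccontr)
      assume "h' \<noteq> h"
      then have "contestants k h' \<inter> contestants k h = {}"
        using feeders_subset[OF assms(1)] assms(3) h'
        by (intro disjoint_family_onD[OF disjoint_contestants]) auto
      with h' assms(4) show False by auto
    qed
  qed
qed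

section \<open>Independence of the results within a round\<close>

lemma result_cong:
  assumes "\<And>g. g \<in> games T \<Longrightarrow> game_round T g \<le> k \<Longrightarrow> w g = w' g" "h \<in> level k"
  shows "result w k h = result w' k h"
  using assms
proof (induction k arbitrary: h)
  case (Suc k)
  have "w h = w' h" using Suc.prems by (simp add: level_Suc)
  moreover have "result w k x = result w' k x" if "x \<in> feeders h" for x
    using that Suc.prems feeders_subset by (intro Suc.IH) auto
  ultimately show ?case by simp
qed simp

lemma players_eq:
  assumes "g \<in> level (Suc k)"
  shows "players T w g = fst ` result w k ` feeders g"
proof (cases k)
  case 0
  then show ?thesis
    using assms by (simp add: players_def feeders_def level_Suc image_image)
next
  case (Suc j)
  then show ?thesis
    using assms by (simp add: players_def feeders_def level_Suc image_image)
qed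

lemma play_cong:
  assumes "\<And>h. h \<in> feeders g \<Longrightarrow> s h = s' h" shows "play g s = play g s'"
proof -
  have "s ` feeders g = s' ` feeders g" using assms by (intro image_cong) auto
  then show ?thesis using assms by (simp add: play_def)
qed

text \<open>The induction replaces the full history of winners by the results of the current level,
  which are all that the next round depends on. The product of the laws of these results is then
  pushed through one round by \<open>Pi_pmf_bind_disjoint\<close>. The default \<open>(0, 0)\<close>
  off the level makes both sides agree as functions.\<close>

lemma map_winners_pmf:
  "map_pmf (\<lambda>w g. if g \<in> level k then result w k g else (0, 0)) (winners_pmf T P k) =
     Pi_pmf (level k) (0, 0) (law k)"
proof (induction k)
  case 0
  then show ?case by (simp add: fun_eq_iff)
next
  case (Suc k)
  let ?L = "level (Suc k)"
  let ?r = "\<lambda>w g. if g \<in> level k then result w k g else (0, 0)"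
  have L: "round_games T (Suc k) = ?L" by (simp add: level_def)
  \<comment> \<open>For fixed earlier winners \<open>w\<close> the new results form a product that
    depends on \<open>w\<close> only through \<open>?r w\<close>; this makes the induction
    hypothesis applicable.\<close>
  have games: "map_pmf (\<lambda>v g. if g \<in> ?L then result (\<lambda>g. if g \<in> ?L then v g else w g) (Suc k) g else (0, 0))
        (Pi_pmf ?L 0 (\<lambda>g. winner_pmf P (players T w g))) = Pi_pmf ?L (0, 0) (\<lambda>g. play g (?r w))" for w
  proof -
    have "result (\<lambda>g. if g \<in> ?L then v g else w g) (Suc k) g =
        (v g, (\<Sum>h\<in>feeders g. snd (?r w h)) + points g (v g))" if "g \<in> ?L" for v g
    proof -
      \<comment> \<open>Entering the winners of round \<open>Suc k\<close> cannot affect a feeder,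
        whose result involves rounds up to \<open>k\<close> only.\<close>
      have "result (\<lambda>g. if g \<in> ?L then v g else w g) k h = ?r w h" if "h \<in> feeders g" for h
        using that feeders_subset[OF \<open>g \<in> ?L\<close>]
        by (subst result_cong[where w' = w]) (auto simp: level_Suc)
      then show ?thesis using that by simp
    qed
    then have "map_pmf (\<lambda>v g. if g \<in> ?L then result (\<lambda>g. if g \<in> ?L then v g else w g) (Suc k) g else (0, 0))
        (Pi_pmf ?L 0 (\<lambda>g. winner_pmf P (players T w g))) =
      map_pmf (\<lambda>v g. if g \<in> ?L then (v g, (\<Sum>h\<in>feeders g. snd (?r w h)) + points g (v g)) else (0, 0))
        (Pi_pmf ?L 0 (\<lambda>g. winner_pmf P (players T w g)))"
      by (intro pmf.map_cong refl ext) (simp del: result.simps)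
    also have "\<dots> = Pi_pmf ?L (0, 0) (\<lambda>g. map_pmf (\<lambda>u. (u, (\<Sum>h\<in>feeders g. snd (?r w h)) + points g u))
        (winner_pmf P (players T w g)))"
      by (rule map_Pi_pmf_dependent) simp
    also have "\<dots> = Pi_pmf ?L (0, 0) (\<lambda>g. play g (?r w))"
    proof (rule Pi_pmf_cong)
      fix g assume g: "g \<in> ?L"
      have "result w k ` feeders g = ?r w ` feeders g"
        using feeders_subset[OF g] by (intro image_cong) auto
      then show "map_pmf (\<lambda>u. (u, (\<Sum>h\<in>feeders g. snd (?r w h)) + points g u))
          (winner_pmf P (players T w g)) = play g (?r w)"
        by (simp add: play_def players_eq[OF g])
    qed auto
    finally show ?thesis .
  qed
  have "map_pmf (\<lambda>w g. if g \<in> ?L then result w (Suc k) g else (0, 0)) (winners_pmf T P (Suc k)) =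
      bind_pmf (winners_pmf T P k) (\<lambda>w. Pi_pmf ?L (0, 0) (\<lambda>g. play g (?r w)))"
    by (simp add: map_bind_pmf pmf.map_comp o_def L flip: games del: result.simps)
  also have "\<dots> = bind_pmf (map_pmf ?r (winners_pmf T P k)) (\<lambda>s. Pi_pmf ?L (0, 0) (\<lambda>g. play g s))"
    by (simp add: bind_map_pmf)
  also have "\<dots> = bind_pmf (Pi_pmf (level k) (0, 0) (law k)) (\<lambda>s. Pi_pmf ?L (0, 0) (\<lambda>g. play g s))"
    by (simp only: Suc.IH)
  also have "\<dots> = Pi_pmf ?L (0, 0) (\<lambda>g. bind_pmf (Pi_pmf (feeders g) (0, 0) (law k)) (play g))"
    using feeders_subset disjoint_feeders
    by (intro Pi_pmf_bind_disjoint play_cong) auto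
  also have "\<dots> = Pi_pmf ?L (0, 0) (law (Suc k))"
    by (intro Pi_pmf_cong refl) simp
  finally show ?case .
qed

lemma law_Suc_pair:
  assumes "feeders g = {h, h'}" "h \<noteq> h'"
  shows "law (Suc k) g = bind_pmf (law k h) (\<lambda>s. bind_pmf (law k h') (\<lambda>s'.
    map_pmf (\<lambda>u. (u, snd s + snd s' + points g u)) (winner_pmf P {fst s, fst s'})))"
proof -
  have 1: "Pi_pmf {h'} (0, 0) (law k) = map_pmf (\<lambda>s'. (\<lambda>_. (0, 0))(h' := s')) (law k h')"
    by (simp add: Pi_pmf_singleton fun_upd_def)
  have 2: "Pi_pmf {h, h'} (0, 0) (law k) = bind_pmf (law k h) (\<lambda>s. bind_pmf (law k h') (\<lambda>s'.
      return_pmf ((\<lambda>_. (0, 0))(h' := s', h := s))))"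
    using assms(2) by (subst Pi_pmf_insert') (auto simp: 1 bind_map_pmf)
  show ?thesis
    using assms by (simp add: 2 bind_assoc_pmf bind_return_pmf play_def insert_commute)
qed

section \<open>Bounds on score codes and the recurrence for their law\<close>

lemma base_ge_2: "base \<ge> 2"
proof -
  have "num_teams T \<ge> 2 ^ 1" unfolding num_teams_def using rounds_pos by (intro power_increasing) auto
  then have "2 * 1 \<le> num_teams T * rounds T" using rounds_pos by (intro mult_le_mono) auto
  then show ?thesis by (simp add: base_def)
qed

lemma entry_le_1:
  assumes "i < e" shows "E (Suc i) u g \<le> 1"
proof -
  have "E (Suc i) u g \<in> {0, 1}"
    using feasible[of "Suc i"] assms by (simp add: feasible_bracket_def)
  then show ?thesis by auto
qed

lemma points_le:
  assumes "g \<in> level (Suc k)" shows "points g u \<le> 2 ^ k * (\<Sum>i<e. base ^ i)"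
proof -
  have "points g u \<le> (\<Sum>i<e. 2 ^ k * 1 * base ^ i)"
    unfolding points_def using assms entry_le_1
    by (intro sum_mono mult_le_mono) (auto simp: level_Suc)
  then show ?thesis by (simp add: sum_distrib_left)
qed

text \<open>In the part of the bracket that ends with a game of level \<open>k\<close> there are
  \<open>2 ^ (k - j)\<close> games of round \<open>j\<close>, worth \<open>2 ^ (j - 1)\<close> each.
  This gives \<open>2 ^ (k - 1)\<close> points per round and \<open>k * 2 ^ (k - 1)\<close> for one
  entry; the geometric sum puts this bound at every digit. The induction step doubles the bound for
  the two halves and adds \<open>2 ^ k\<close> for the game itself.\<close>

lemma set_law:
  "g \<in> level k \<Longrightarrow> set_pmf (law k g) \<subseteq> contestants k g \<times> {..k * 2 ^ (k - 1) * (\<Sum>i<e. base ^ i)}"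
proof (induction k arbitrary: g)
  case 0
  then show ?case by (simp add: contestants_def)
next
  case (Suc k)
  let ?G = "\<Sum>i<e. base ^ i"
  obtain h h' where h: "feeders g = {h, h'}" "h \<noteq> h'" using feedersE[OF Suc.prems] .
  have hl: "h \<in> level k" "h' \<in> level k" using feeders_subset[OF Suc.prems] h by auto
  have bound: "2 * (k * 2 ^ (k - 1) * ?G) + 2 ^ k * ?G = Suc k * 2 ^ (Suc k - 1) * ?G"
    by (cases k) (auto simp: algebra_simps)
  show ?case
  proof safe
    fix u c assume "(u, c) \<in> set_pmf (law (Suc k) g)"
    then obtain s s' where s: "s \<in> set_pmf (law k h)" "s' \<in> set_pmf (law k h')"
      and u: "u \<in> set_pmf (winner_pmf P {fst s, fst s'})" and c: "c = snd s + snd s' + points g u"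
      by (auto simp: law_Suc_pair[OF h] simp del: law.simps)
    have s_in: "fst s \<in> contestants k h" "snd s \<le> k * 2 ^ (k - 1) * ?G"
      "fst s' \<in> contestants k h'" "snd s' \<le> k * 2 ^ (k - 1) * ?G"
      using subsetD[OF Suc.IH[OF hl(1)] s(1)] subsetD[OF Suc.IH[OF hl(2)] s(2)]
      by (simp_all add: mem_Times_iff)
    have "u = fst s \<or> u = fst s'" using set_winner_pmf u by blast
    then show "u \<in> contestants (Suc k) g"
      using s_in h by (auto simp: game_teams_feeders[OF Suc.prems])
    show "c \<le> Suc k * 2 ^ (Suc k - 1) * ?G"
      using s_in points_le[OF Suc.prems, of u] bound unfolding c by linarith
  qed
qed

lemma weight_bound:
  assumes "k \<le> rounds T" shows "k * 2 ^ (k - 1) < base"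
proof -
  have "k * 2 ^ (k - 1) \<le> rounds T * 2 ^ (rounds T - 1)"
    using assms by (intro mult_le_mono power_increasing) auto
  also have "\<dots> < rounds T * 2 ^ rounds T"
    using rounds_pos by (intro mult_strict_left_mono power_strict_increasing) auto
  finally show ?thesis by (simp add: base_def num_teams_def mult.commute)
qed

lemma geometric_base: "(base - 1) * (\<Sum>i<e. base ^ i) = base ^ e - 1"
proof -
  have "base * (\<Sum>i<e. base ^ i) + 1 = (\<Sum>i<e. base ^ i) + base ^ e"
    by (induction e) (simp_all add: algebra_simps)
  then show ?thesis by (simp add: diff_mult_distrib)
qed

text \<open>The points of an entry are at most \<open>base - 1\<close>, and \<open>base - 1\<close>
  at every digit gives \<open>base ^ e - 1\<close>. All sums over codes may therefore stop at
  \<open>base ^ e\<close>.\<close>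

lemma set_law_code:
  assumes "g \<in> level k" shows "set_pmf (law k g) \<subseteq> contestants k g \<times> {..<base ^ e}"
proof -
  let ?G = "\<Sum>i<e. base ^ i"
  have "k \<le> rounds T" using level_range assms by (metis emptyE not_le)
  then have "k * 2 ^ (k - 1) * ?G \<le> (base - 1) * ?G"
    using weight_bound[of k] by (intro mult_le_mono) auto
  also have "\<dots> < base ^ e"
    using base_ge_2 unfolding geometric_base by simp
  finally show ?thesis using set_law[OF assms] by auto
qed

text \<open>The two halves share no team, so \<open>u\<close> can only have come from
  \<open>h\<close>, and the sum over the winners of \<open>h\<close> collapses to \<open>u\<close>.
  What remains of the other half is a factor free of \<open>a\<close>. The test for each pair
  \<open>a\<close>, \<open>d\<close> anticipates a program that adds every product to the cell
  \<open>a + d + points g u\<close>.\<close>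

lemma pmf_law_Suc:
  assumes g: "g \<in> level (Suc k)" and h: "feeders g = {h, h'}" "h \<noteq> h'" and u: "u \<in> contestants k h"
  shows "pmf (law (Suc k) g) (u, c) = (\<Sum>a<base ^ e. \<Sum>d<base ^ e. if a + d + points g u = c
    then pmf (law k h) (u, a) * (\<Sum>v\<in>contestants k h'. P u v * pmf (law k h') (v, d)) else 0)"
proof -
  let ?n = "base ^ e" and ?C = "contestants k h" and ?C' = "contestants k h'"
  have hl: "h \<in> level k" "h' \<in> level k" using feeders_subset[OF g] h by auto
  have fin: "finite ?C" "finite ?C'" using hl finite_contestants by auto
  have disj: "?C \<inter> ?C' = {}"
    using disjoint_family_onD[OF disjoint_contestants hl h(2)] .
  have teams: "?C \<subseteq> teams T" "?C' \<subseteq> teams T" using hl contestants_teams by auto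
  have W: "pmf (winner_pmf P {x, y}) u = (if x = u then P u y else 0)" if "x \<in> ?C" "y \<in> ?C'" for x y
  proof -
    have "y \<noteq> u" "y \<noteq> x" using that u disj by auto
    moreover have "pmf (winner_pmf P {u, y}) u = P u y" if "x = u"
    proof -
      have "u \<in> teams T" "y \<in> teams T" using teams u \<open>y \<in> ?C'\<close> by auto
      then show ?thesis
        using probs \<open>y \<noteq> u\<close> by (intro pmf_winner_pmf) (auto simp: win_probabilities_def)
    qed
    moreover have "pmf (winner_pmf P {x, y}) u = 0" if "x \<noteq> u"
      using set_winner_pmf[of P x y] that \<open>y \<noteq> u\<close> by (auto simp: set_pmf_eq)
    ultimately show ?thesis by auto
  qed
  have "pmf (law (Suc k) g) (u, c) = (\<Sum>s\<in>?C \<times> {..<?n}. pmf (law k h) s * (\<Sum>s'\<in>?C' \<times> {..<?n}.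
      pmf (law k h') s' * (if snd s + snd s' + points g u = c then pmf (winner_pmf P {fst s, fst s'}) u else 0)))"
    unfolding law_Suc_pair[OF h]
    using fin set_law_code hl by (simp add: pmf_bind_finite[where S = "?C \<times> {..<?n}"] 
        pmf_bind_finite[where S = "?C' \<times> {..<?n}"] pmf_map_graph)
  also have "\<dots> = (\<Sum>x\<in>?C. \<Sum>a<?n. pmf (law k h) (x, a) * (\<Sum>y\<in>?C'. \<Sum>d<?n.
      pmf (law k h') (y, d) * (if a + d + points g u = c then if x = u then P u y else 0 else 0)))"
    by (simp add: sum.cartesian_product' W cong: sum.cong if_cong)
  also have "\<dots> = (\<Sum>x\<in>?C. if x = u then \<Sum>a<?n. pmf (law k h) (u, a) * (\<Sum>y\<in>?C'. \<Sum>d<?n.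
      pmf (law k h') (y, d) * (if a + d + points g u = c then P u y else 0)) else 0)"
    by (intro sum.cong refl) (simp cong: if_cong)
  also have "\<dots> = (\<Sum>a<?n. pmf (law k h) (u, a) * (\<Sum>y\<in>?C'. \<Sum>d<?n.
      pmf (law k h') (y, d) * (if a + d + points g u = c then P u y else 0)))"
    by (simp only: sum.delta[OF fin(1)] u if_True)
  also have "\<dots> = (\<Sum>a<?n. \<Sum>d<?n. if a + d + points g u = c
      then pmf (law k h) (u, a) * (\<Sum>v\<in>?C'. P u v * pmf (law k h') (v, d)) else 0)"
    by (subst sum.swap) (auto simp: sum_distrib_left mult_ac intro!: sum.cong)
  finally show ?thesis .
qed

text \<open>Each result of level \<open>k\<close> is used by exactly one game of level
  \<open>Suc k\<close>, by \<open>Union_feeders\<close> and disjointness, so points are neither lost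
  nor counted twice.\<close>

lemma sum_level_result:
  "k \<le> rounds T \<Longrightarrow> (\<Sum>h\<in>level k. snd (result w k h)) =
     (\<Sum>g | g \<in> games T \<and> game_round T g \<le> k. points g (w g))"
proof (induction k)
  case 0
  have "{g. g \<in> games T \<and> game_round T g \<le> 0} = {}"
    using game_round_range by fastforce
  then show ?case by (simp only: sum.empty) simp
next
  case (Suc k)
  have "(\<Sum>g\<in>level (Suc k). snd (result w (Suc k) g)) =
      (\<Sum>g\<in>level (Suc k). \<Sum>h\<in>feeders g. snd (result w k h)) + (\<Sum>g\<in>level (Suc k). points g (w g))"
    by (simp add: sum.distrib)
  also have "(\<Sum>g\<in>level (Suc k). \<Sum>h\<in>feeders g. snd (result w k h)) = (\<Sum>h\<in>level k. snd (result w k h))"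
    using disjoint_feeders[of k] finite_feeders Suc.prems
    by (subst Union_feeders[symmetric], simp, subst sum.UNION_disjoint) (auto simp: disjoint_family_on_def)
  also have "\<dots> = (\<Sum>g | g \<in> games T \<and> game_round T g \<le> k. points g (w g))"
    using Suc by simp
  also have "\<dots> + (\<Sum>g\<in>level (Suc k). points g (w g)) =
      (\<Sum>g\<in>{g. g \<in> games T \<and> game_round T g \<le> k} \<union> level (Suc k). points g (w g))"
    by (subst sum.union_disjoint) (auto simp: level_Suc games_def)
  also have "{g. g \<in> games T \<and> game_round T g \<le> k} \<union> level (Suc k) = {g \<in> games T. game_round T g \<le> Suc k}"
    by (auto simp: level_Suc)
  finally show ?case .
qed

section \<open>Scores as digits of the code of the final\<close>

definition final :: nat where "final = (THE g. level (rounds T) = {g})"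

lemma level_rounds: "level (rounds T) = {final}"
proof -
  have "card (level (rounds T)) = 1" by (simp add: card_level)
  then obtain g where "level (rounds T) = {g}" by (auto simp: card_1_singleton_iff)
  then show ?thesis by (simp add: final_def)
qed

definition outcome :: "(nat \<Rightarrow> nat) \<Rightarrow> bracket" where
  "outcome w = (\<lambda>t g. if t \<in> teams T \<and> g \<in> games T \<and> w g = t then 1 else 0)"

text \<open>This holds for every \<open>w\<close>, whatever its probability: if \<open>w g\<close>
  is no team, the sum over teams contributes nothing for \<open>g\<close>, and a feasible entry is 0
  there as well.\<close>

lemma score_outcome:
  assumes "i < e"
  shows "score T (E (Suc i)) (outcome w) = (\<Sum>g\<in>games T. 2 ^ (game_round T g - 1) * E (Suc i) (w g) g)"
proof -
  have zero: "E (Suc i) t g = 0" if "t \<notin> teams T" for t g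
    using feasible[of "Suc i"] assms that by (auto simp: feasible_bracket_def)
  have "score T (E (Suc i)) (outcome w) =
      (\<Sum>g\<in>games T. \<Sum>t\<in>teams T. 2 ^ (game_round T g - 1) * E (Suc i) t g * outcome w t g)"
    unfolding score_def by (rule sum.swap)
  also have "\<dots> = (\<Sum>g\<in>games T. \<Sum>t\<in>teams T. if w g = t then 2 ^ (game_round T g - 1) * E (Suc i) t g else 0)"
    by (intro sum.cong) (auto simp: outcome_def)
  also have "\<dots> = (\<Sum>g\<in>games T. 2 ^ (game_round T g - 1) * E (Suc i) (w g) g)"
    by (intro sum.cong refl) (auto simp: teams_def zero[unfolded teams_def])
  finally show ?thesis .
qed

text \<open>The number of games in a round and the points per game balance: every round is worth
  \<open>2 ^ (rounds T - 1)\<close> in total, whichever it is.\<close>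

lemma score_less:
  assumes "i < e" shows "score T (E (Suc i)) (outcome w) < base"
proof -
  have "score T (E (Suc i)) (outcome w) \<le> (\<Sum>g\<in>games T. 2 ^ (game_round T g - 1))"
    unfolding score_outcome[OF assms] using entry_le_1[OF assms] by (intro sum_mono) auto
  also have "\<dots> = (\<Sum>k\<in>{1..rounds T}. \<Sum>g | g \<in> games T \<and> game_round T g = k. (2::nat) ^ (game_round T g - 1))"
    using game_round_range by (intro sum.group[symmetric]) (auto simp: games_def)
  also have "\<dots> = (\<Sum>k\<in>{1..rounds T}. 2 ^ (rounds T - 1))"
  proof (intro sum.cong refl)
    fix k assume k: "k \<in> {1..rounds T}"
    have "{g \<in> games T. game_round T g = k} = level k"
      using k by (auto simp: level_def round_games_def)
    then have "(\<Sum>g | g \<in> games T \<and> game_round T g = k. (2::nat) ^ (game_round T g - 1)) =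
        (\<Sum>g\<in>level k. (2::nat) ^ (k - 1))" by (intro sum.cong) auto
    also have "\<dots> = card (level k) * 2 ^ (k - 1)" by simp
    also have "card (level k) = 2 ^ (rounds T - k)"
      using k by (simp add: card_level)
    also have "(2::nat) ^ (rounds T - k) * 2 ^ (k - 1) = 2 ^ (rounds T - 1)"
      using k by (simp flip: power_add)
    finally show "(\<Sum>g | g \<in> games T \<and> game_round T g = k. (2::nat) ^ (game_round T g - 1)) = (2::nat) ^ (rounds T - 1)" .
  qed
  also have "\<dots> < base" using weight_bound[of "rounds T"] by simp
  finally show ?thesis .
qed

lemma max_score_outcome:
  "max_score T (E ` {1..e}) (outcome w) = max_digit base (snd (result w (rounds T) final))"
proof -
  let ?s = "\<lambda>i. score T (E (Suc i)) (outcome w)"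
  have "snd (result w (rounds T) final) = (\<Sum>g\<in>games T. points g (w g))"
  proof -
    have "{g \<in> games T. game_round T g \<le> rounds T} = games T"
      using game_round_range by auto
    then show ?thesis using sum_level_result[of "rounds T" w] by (simp add: level_rounds)
  qed
  also have "\<dots> = (\<Sum>i<e. \<Sum>g\<in>games T. 2 ^ (game_round T g - 1) * E (Suc i) (w g) g * base ^ i)"
    unfolding points_def by (rule sum.swap)
  also have "\<dots> = (\<Sum>i<e. ?s i * base ^ i)"
    by (simp add: score_outcome sum_distrib_right)
  finally have "max_digit base (snd (result w (rounds T) final)) = Max (insert 0 (?s ` {..<e}))"
    using max_digit_sum[OF base_ge_2 score_less] by simp
  \<comment> \<open>The extra 0 is harmless: scores are naturals, and \<open>e \<ge> 1\<close> keeps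
    the set of scores nonempty.\<close>
  also have "\<dots> = Max (?s ` {..<e})"
    using entries_pos by (subst Max_insert) (auto simp: lessThan_empty_iff)
  also have "?s ` {..<e} = (\<lambda>B. score T B (outcome w)) ` E ` {1..e}"
    by (simp only: image_image image_Suc_lessThan[symmetric])
  finally show ?thesis by (simp add: max_score_def)
qed

text \<open>The last level consists of the final alone, so the law of its result is a marginal of
  the product in \<open>map_winners_pmf\<close>. Its finite support turns the expectation into a
  sum.\<close>

lemma expected_max_score_eq:
  "expected_max_score T P (E ` {1..e}) =
     (\<Sum>u\<in>teams T. \<Sum>c<base ^ e. pmf (law (rounds T) final) (u, c) * real (max_digit base c))"
proof -
  have final: "final \<in> level (rounds T)" by (simp add: level_rounds)
  have teams: "contestants (rounds T) final = teams T"
    using Union_contestants[of "rounds T"] by (simp add: level_rounds)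
  have law: "map_pmf (\<lambda>w. result w (rounds T) final) (winners_pmf T P (rounds T)) = law (rounds T) final"
  proof -
    have "map_pmf (\<lambda>s. s final) (map_pmf (\<lambda>w g. if g \<in> level (rounds T) then result w (rounds T) g else (0, 0))
        (winners_pmf T P (rounds T))) = law (rounds T) final"
      unfolding map_winners_pmf by (simp add: Pi_pmf_component final)
    then show ?thesis using final by (simp add: pmf.map_comp o_def)
  qed
  have "expected_max_score T P (E ` {1..e}) =
      measure_pmf.expectation (winners_pmf T P (rounds T)) (\<lambda>w. real (max_score T (E ` {1..e}) (outcome w)))"
    by (simp add: expected_max_score_def outcome_pmf_def outcome_def)
  also have "\<dots> = measure_pmf.expectation (map_pmf (\<lambda>w. result w (rounds T) final) (winners_pmf T P (rounds T)))
      (\<lambda>s. real (max_digit base (snd s)))"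
    unfolding max_score_outcome by simp
  also have "\<dots> = (\<Sum>s\<in>teams T \<times> {..<base ^ e}. real (max_digit base (snd s)) * pmf (law (rounds T) final) s)"
    unfolding law using set_law_code[OF final]
    by (intro integral_measure_pmf_real) (auto simp: teams teams_def)
  also have "\<dots> = (\<Sum>u\<in>teams T. \<Sum>c<base ^ e. pmf (law (rounds T) final) (u, c) * real (max_digit base c))"
    by (simp add: sum.cartesian_product' mult.commute)
  finally show ?thesis .
qed

end

section \<open>The program\<close>

abbreviation (input) Var :: "string \<Rightarrow> nexp" where "Var x \<equiv> NGet x []"

definition base_prog :: com where
  "base_prog = Seq (NPut ''b'' [] (NConst 0))
     (For ''j'' 0 (Var ''rounds'') (NPut ''b'' [] (NAdd (Var ''b'') (Var ''teams''))))"

definition power_prog :: com where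
  "power_prog = Seq (NPut ''n'' [] (NConst 1))
     (For ''i'' 0 (Var ''entries'')
       (Seq (NPut ''pw'' [Var ''i''] (Var ''n''))
       (Seq (NPut ''x'' [] (NConst 0))
       (Seq (For ''j'' 0 (Var ''b'') (NPut ''x'' [] (NAdd (Var ''x'') (Var ''n''))))
            (NPut ''n'' [] (Var ''x''))))))"

text \<open>Division is unavailable, so \<open>q\<close> and \<open>d\<close> are counted along as quotient and remainder of \<open>c\<close>.\<close>

definition digit_prog :: com where
  "digit_prog = Seq (NPut ''q'' [] (NConst 0)) (Seq (NPut ''d'' [] (NConst 0))
     (Seq (NPut ''mx'' [NConst 0] (NConst 0))
     (For ''c'' 0 (Var ''n'')
       (Seq (Cond (NLess (NGet ''mx'' [Var ''q'']) (Var ''d''))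
               (NPut ''mx'' [Var ''c''] (Var ''d''))
               (NPut ''mx'' [Var ''c''] (NGet ''mx'' [Var ''q''])))
       (Seq (NPut ''d'' [] (NAdd (Var ''d'') (NConst 1)))
            (Cond (NLess (Var ''d'') (Var ''b'')) Skip
               (Seq (NPut ''d'' [] (NConst 0)) (NPut ''q'' [] (NAdd (Var ''q'') (NConst 1))))))))))"

definition leaf_prog :: com where
  "leaf_prog = For ''u'' 1 (NAdd (Var ''teams'') (NConst 1))
     (Seq (For ''c'' 0 (Var ''n'') (RPut ''F'' [NConst 0, Var ''u'', Var ''c''] (ROfNat (NConst 0))))
          (RPut ''F'' [NConst 0, Var ''u'', NConst 0] (ROfNat (NConst 1))))"

text \<open>All entries that picked \<open>u\<close> earn the same \<open>2 ^ k\<close> points, so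
  the weight is applied once, by doubling the sum of the powers \<open>k\<close> times.\<close>

definition points_prog :: com where
  "points_prog = Seq (NPut ''x'' [] (NConst 0))
     (Seq (For ''i'' 0 (Var ''entries'')
             (Cond (NLess (NConst 0) (NGet ''E'' [NAdd (Var ''i'') (NConst 1), Var ''u'', Var ''g'']))
                (NPut ''x'' [] (NAdd (Var ''x'') (NGet ''pw'' [Var ''i'']))) Skip))
          (For ''j'' 0 (Var ''k'') (NPut ''x'' [] (NAdd (Var ''x'') (Var ''x'')))))"

text \<open>Opponents of \<open>u\<close> are the players of \<open>g\<close> from the other half.
  Distinct predecessor games detect this, except in the first round, where \<open>pred\<close> is
  unspecified and a half is a single team.\<close>

definition opponent_exp :: bexp where
  "opponent_exp = BAnd (eq_exp (NGet ''plays'' [Var ''g'', Var ''v'']) (NConst 1))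
     (or_exp (BAnd (NLess (Var ''k'') (NConst 1)) (BNot (eq_exp (Var ''u'') (Var ''v''))))
        (BAnd (NLess (NConst 0) (Var ''k''))
           (BNot (eq_exp (NGet ''pred'' [Var ''g'', Var ''u'']) (NGet ''pred'' [Var ''g'', Var ''v''])))))"

definition opponent_prog :: com where
  "opponent_prog = Seq (RPut ''y'' [] (ROfNat (NConst 0)))
     (For ''v'' 1 (NAdd (Var ''teams'') (NConst 1))
       (Cond opponent_exp
          (RPut ''y'' [] (RAdd (RGet ''y'' [])
             (RMul (RGet ''P'' [Var ''u'', Var ''v'']) (RGet ''F'' [Var ''k'', Var ''v'', Var ''d'']))))
          Skip))"

text \<open>
  For \<open>a + d + x \<ge> n\<close> this reads and writes cells with uninitialised contents, which no
  other part of the program uses.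
\<close>

definition convolution_prog :: com where
  "convolution_prog = Seq
     (For ''c'' 0 (Var ''n'')
        (RPut ''F'' [NAdd (Var ''k'') (NConst 1), Var ''u'', Var ''c''] (ROfNat (NConst 0))))
     (For ''d'' 0 (Var ''n'') (Seq opponent_prog
       (For ''a'' 0 (Var ''n'')
          (RPut ''F'' [NAdd (Var ''k'') (NConst 1), Var ''u'', NAdd (NAdd (Var ''a'') (Var ''d'')) (Var ''x'')]
             (RAdd (RGet ''F'' [NAdd (Var ''k'') (NConst 1), Var ''u'', NAdd (NAdd (Var ''a'') (Var ''d'')) (Var ''x'')])
                (RMul (RGet ''F'' [Var ''k'', Var ''u'', Var ''a'']) (RGet ''y'' [])))))))"

text \<open>
  A team plays one game per round, so the array \<open>F\<close> is indexed by rounds and teams. Scanning all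
  triples of a round, a game and a team already meets the time bound.
\<close>

definition rounds_prog :: com where
  "rounds_prog = For ''k'' 0 (Var ''rounds'') (For ''g'' 1 (Var ''teams'')
     (For ''u'' 1 (NAdd (Var ''teams'') (NConst 1))
       (Cond (BAnd (eq_exp (NGet ''round'' [Var ''g'']) (NAdd (Var ''k'') (NConst 1)))
                (eq_exp (NGet ''plays'' [Var ''g'', Var ''u'']) (NConst 1)))
          (Seq points_prog convolution_prog) Skip)))"

definition sum_prog :: com where
  "sum_prog = Seq (RPut ''result'' [] (ROfNat (NConst 0)))
     (For ''u'' 1 (NAdd (Var ''teams'') (NConst 1)) (For ''c'' 0 (Var ''n'')
        (RPut ''result'' [] (RAdd (RGet ''result'' [])
           (RMul (RGet ''F'' [Var ''rounds'', Var ''u'', Var ''c'']) (ROfNat (NGet ''mx'' [Var ''c'']))))))) "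

definition program :: com where
  "program = Seq base_prog (Seq power_prog (Seq digit_prog (Seq leaf_prog (Seq rounds_prog sum_prog))))"

lemma opponent_prog_writes [simp]:
  "nat_writes opponent_prog = {''v''}" "real_writes opponent_prog = {''y''}"
  by (auto simp: opponent_prog_def)

lemma points_prog_writes [simp]:
  "nat_writes points_prog = {''x'', ''i'', ''j''}" "real_writes points_prog = {}"
  by (auto simp: points_prog_def)

lemma convolution_prog_writes [simp]:
  "nat_writes convolution_prog = {''c'', ''d'', ''v'', ''a''}" "real_writes convolution_prog = {''F'', ''y''}"
  by (auto simp: convolution_prog_def)

section \<open>Correctness and running time of the program\<close>

context bracket_pool
begin

abbreviation codes :: nat where "codes \<equiv> base ^ e"

definition input :: "memory \<Rightarrow> bool" where "input m = holds_input m T P e E"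

lemma inputD:
  assumes "input m"
  shows "nat_mem m ''rounds'' [] = rounds T" "nat_mem m ''teams'' [] = num_teams T"
    "nat_mem m ''entries'' [] = e"
    "g \<in> games T \<Longrightarrow> nat_mem m ''round'' [g] = game_round T g"
    "g \<in> games T \<Longrightarrow> u \<in> teams T \<Longrightarrow> nat_mem m ''plays'' [g, u] = (if u \<in> game_teams T g then 1 else 0)"
    "g \<in> games T \<Longrightarrow> u \<in> game_teams T g \<Longrightarrow> game_round T g > 1 \<Longrightarrow> nat_mem m ''pred'' [g, u] = predecessor_of T g u"
    "u \<in> teams T \<Longrightarrow> v \<in> teams T \<Longrightarrow> real_mem m ''P'' [u, v] = P u v"
    "i < e \<Longrightarrow> u \<in> teams T \<Longrightarrow> g \<in> games T \<Longrightarrow> nat_mem m ''E'' [Suc i, u, g] = E (Suc i) u g"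
  using assms by (auto simp: input_def holds_input_def)

definition ready :: "memory \<Rightarrow> bool" where
  "ready m \<longleftrightarrow> input m \<and> nat_mem m ''n'' [] = codes \<and> (\<forall>i<e. nat_mem m ''pw'' [i] = base ^ i) \<and>
     (\<forall>c<codes. nat_mem m ''mx'' [c] = max_digit base c)"

text \<open>The listed names are the scratch variables and arrays written by
  \<open>leaf_prog\<close>, \<open>rounds_prog\<close> and \<open>sum_prog\<close>. None of them
  holds input or a table prepared earlier.\<close>

lemma ready_frame:
  assumes "ready m"
    and "\<And>x. x \<notin> {''x'', ''i'', ''j'', ''c'', ''d'', ''v'', ''a'', ''k'', ''g'', ''u''} \<Longrightarrow> nat_mem m' x = nat_mem m x"
    and "\<And>x. x \<notin> {''F'', ''y'', ''result''} \<Longrightarrow> real_mem m' x = real_mem m x"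
  shows "ready m'"
  using assms(1) by (simp add: ready_def input_def holds_input_def assms(2,3))

text \<open>Every secondary loop is charged to \<open>codes\<close>. For \<open>e\<close> this uses
  \<open>e < 2 ^ e\<close> and \<open>base \<ge> 2\<close>, for the other quantities
  \<open>base \<le> base ^ e\<close>.\<close>

lemma size_bounds:
  "e \<le> codes" "base \<le> codes" "rounds T \<le> codes" "num_teams T \<le> codes" "1 \<le> codes"
proof -
  have "e < 2 ^ e" by simp
  also have "(2::nat) ^ e \<le> codes" using base_ge_2 by (intro power_mono) auto
  finally show "e \<le> codes" by simp
  show b: "base \<le> codes" using base_ge_2 entries_pos by (simp add: self_le_power)
  have "rounds T \<le> base" "num_teams T \<le> base"
    using rounds_pos by (simp_all add: base_def num_teams_def)
  with b show "rounds T \<le> codes" "num_teams T \<le> codes" by auto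
  show "1 \<le> codes" using base_ge_2 by simp
qed

lemma codes_square: "1 \<le> codes * codes" "codes \<le> codes * codes"
  using mult_le_mono[OF size_bounds(5) order.refl, of codes] size_bounds(5) by simp_all

lemma runs_base_prog:
  assumes "input m"
  shows "runs base_prog m (100 * codes) (\<lambda>m'. nat_mem m' ''b'' [] = base)"
proof -
  have "runs (For ''j'' 0 (Var ''rounds'') (NPut ''b'' [] (NAdd (Var ''b'') (Var ''teams''))))
      (nat_store ''b'' [] 0 m) (30 * rounds T + 30) (\<lambda>m'. nat_mem m' ''b'' [] = base)"
    by (rule runs_For[where I = "\<lambda>j m'. nat_mem m' ''b'' [] = j * num_teams T" and n = 10 and h = "rounds T"])
       (auto simp: inputD[OF assms] base_def simp: runs_simps)
  then show ?thesis
    unfolding base_prog_def using size_bounds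
    by (intro runs_Seq[OF runs_NPut[where n = 2]]) auto
qed

lemma runs_power_prog:
  assumes "input m" "nat_mem m ''b'' [] = base"
  shows "runs power_prog m (200 * (codes * codes))
    (\<lambda>m'. nat_mem m' ''n'' [] = codes \<and> (\<forall>i<e. nat_mem m' ''pw'' [i] = base ^ i))"
proof -
  let ?I = "\<lambda>i m'. nat_mem m' ''n'' [] = base ^ i \<and> (\<forall>i'<i. nat_mem m' ''pw'' [i'] = base ^ i')"
  have cost: "e * (58 + 20 * base) + 10 \<le> 99 * codes * codes"
  proof -
    have "e * (58 + 20 * base) \<le> codes * (80 * codes)"
      using size_bounds by (intro mult_le_mono) auto
    then show ?thesis using codes_square unfolding mult.assoc mult.left_commute[of codes 80] by linarith
  qed
  have "runs (For ''i'' 0 (Var ''entries'')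
       (Seq (NPut ''pw'' [Var ''i''] (Var ''n''))
       (Seq (NPut ''x'' [] (NConst 0))
       (Seq (For ''j'' 0 (Var ''b'') (NPut ''x'' [] (NAdd (Var ''x'') (Var ''n''))))
            (NPut ''n'' [] (Var ''x''))))))
     (nat_store ''n'' [] 1 m) (99 * codes * codes) (?I e)"
  proof (rule runs_For[where I = ?I and n = "20 * base + 50" and h = e], goal_cases)
    case (6 i m')
    let ?m = "nat_store ''x'' [] 0 (nat_store ''pw'' [i] (base ^ i) m')"
    have b: "nat_mem m' ''b'' [] = base" using 6(5)[of "''b''"] assms(2) by simp
    have "runs (For ''j'' 0 (Var ''b'') (NPut ''x'' [] (NAdd (Var ''x'') (Var ''n'')))) ?m (20 * base + 20)
        (\<lambda>m''. nat_mem m'' ''x'' [] = base ^ Suc i \<and> (\<forall>i'<Suc i. nat_mem m'' ''pw'' [i'] = base ^ i'))"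
      by (rule runs_For[where I = "\<lambda>j m''. nat_mem m'' ''x'' [] = j * base ^ i" and n = 6 and h = base])
         (use 6 b in \<open>auto simp: less_Suc_eq simp: runs_simps\<close>)
    then have "runs (Seq (For ''j'' 0 (Var ''b'') (NPut ''x'' [] (NAdd (Var ''x'') (Var ''n''))))
        (NPut ''n'' [] (Var ''x''))) ?m (20 * base + 40) (?I (Suc i))"
      by (intro runs_Seq[where n = "20 * base + 20" and k = 3], elim runs_frame)
         (auto simp: runs_simps)
    then show ?case
      using 6(3,4) by (auto simp: runs_Seq_put intro: runs_weaken)
  qed (use assms cost in \<open>auto simp: inputD[OF assms(1)]\<close>)
  moreover have "2 + 99 * codes * codes \<le> 200 * (codes * codes)"
    using codes_square unfolding mult.assoc by linarith
  ultimately show ?thesis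
    unfolding power_prog_def
    by (intro runs_Seq[where n = 2 and k = "99 * codes * codes"] runs_NPut) simp_all
qed

lemma runs_digit_prog:
  assumes "nat_mem m ''b'' [] = base" "nat_mem m ''n'' [] = codes"
  shows "runs digit_prog m (100 * codes) (\<lambda>m'. \<forall>c<codes. nat_mem m' ''mx'' [c] = max_digit base c)"
proof -
  \<comment> \<open>The cell \<open>mx [0]\<close> is set in advance because the round for
    \<open>c = 0\<close> reads it: there the quotient is \<open>c\<close> itself. For
    \<open>c > 0\<close> the quotient is smaller than \<open>c\<close>, so its entry is already
    present.\<close>
  let ?I = "\<lambda>c m'. nat_mem m' ''mx'' [0] = 0 \<and> nat_mem m' ''q'' [] = c div base \<and>
     nat_mem m' ''d'' [] = c mod base \<and> (\<forall>c'<c. nat_mem m' ''mx'' [c'] = max_digit base c')"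
  have [simp]: "max_digit base 0 = 0" by (simp add: max_digit.simps)
  have "runs (For ''c'' 0 (Var ''n'')
       (Seq (Cond (NLess (NGet ''mx'' [Var ''q'']) (Var ''d''))
               (NPut ''mx'' [Var ''c''] (Var ''d''))
               (NPut ''mx'' [Var ''c''] (NGet ''mx'' [Var ''q''])))
       (Seq (NPut ''d'' [] (NAdd (Var ''d'') (NConst 1)))
            (Cond (NLess (Var ''d'') (Var ''b'')) Skip
               (Seq (NPut ''d'' [] (NConst 0)) (NPut ''q'' [] (NAdd (Var ''q'') (NConst 1))))))))
     (nat_store ''mx'' [0] 0 (nat_store ''d'' [] 0 (nat_store ''q'' [] 0 m)))
     (50 * codes + 20) (\<lambda>m'. \<forall>c<codes. nat_mem m' ''mx'' [c] = max_digit base c)"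
  proof (rule runs_For[where I = ?I and n = 42 and h = codes], goal_cases)
    case (6 c m')
    have b: "nat_mem m' ''b'' [] = base" using 6(5)[of "''b''"] assms(1) by simp
    have mx: "nat_mem m' ''mx'' [c div base] = max_digit base (c div base)"
      using 6(3) base_ge_2 by (cases "c = 0") auto
    have rec: "max_digit base c = max (c mod base) (max_digit base (c div base))"
      by (rule max_digit_rec[OF base_ge_2])
    have carry: "Suc c div base = (if Suc (c mod base) = base then Suc (c div base) else c div base)"
      "Suc c mod base = (if Suc (c mod base) = base then 0 else Suc (c mod base))"
      using base_ge_2 by (auto simp: div_Suc mod_Suc)
    have less: "c mod base < base" using base_ge_2 by simp
    let ?J = "\<lambda>m''. nat_mem m'' ''mx'' [0] = 0 \<and> nat_mem m'' ''q'' [] = c div base \<and>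
       nat_mem m'' ''d'' [] = c mod base \<and> (\<forall>c'<Suc c. nat_mem m'' ''mx'' [c'] = max_digit base c') \<and>
       nat_mem m'' ''b'' [] = base"
    have "runs (Cond (NLess (NGet ''mx'' [Var ''q'']) (Var ''d''))
               (NPut ''mx'' [Var ''c''] (Var ''d''))
               (NPut ''mx'' [Var ''c''] (NGet ''mx'' [Var ''q'']))) m' 12 ?J"
      using 6(3,4) b mx by (auto simp: runs_simps less_Suc_eq rec)
    moreover have "runs (Seq (NPut ''d'' [] (NAdd (Var ''d'') (NConst 1)))
            (Cond (NLess (Var ''d'') (Var ''b'')) Skip
               (Seq (NPut ''d'' [] (NConst 0)) (NPut ''q'' [] (NAdd (Var ''q'') (NConst 1)))))) m'' 25 (?I (Suc c))"
      if "?J m''" for m''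
      using that less by (auto simp: runs_simps carry)
    ultimately show ?case
      by (intro runs_Seq[where n = 12 and k = 25]) (auto elim: runs_frame)
  qed (use assms base_ge_2 in auto)
  then show ?thesis
    unfolding digit_prog_def using size_bounds(5)
    by (auto simp: runs_Seq_put intro: runs_weaken)
qed

definition table :: "nat \<Rightarrow> memory \<Rightarrow> bool" where
  "table k m \<longleftrightarrow> (\<forall>h\<in>level k. \<forall>u\<in>contestants k h. \<forall>c<codes. real_mem m ''F'' [k, u, c] = pmf (law k h) (u, c))"

lemma runs_leaf_prog:
  assumes "ready m"
  shows "runs leaf_prog m (200 * (codes * codes)) (table 0)"
proof -
  let ?I = "\<lambda>u m'. \<forall>v\<in>{1..<u}. \<forall>c<codes. real_mem m' ''F'' [0, v, c] = (if c = 0 then 1 else 0)"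
  have m: "nat_mem m ''n'' [] = codes" "nat_mem m ''teams'' [] = num_teams T"
    using assms by (auto simp: ready_def inputD)
  have table: "table 0 m'" if "?I (num_teams T + 1) m'" for m'
    using that by (auto simp: table_def level_def contestants_def teams_def indicator_def)
  have "num_teams T * (50 + 20 * codes) \<le> codes * (90 * codes)"
    using size_bounds by (intro mult_le_mono) auto
  then have cost: "num_teams T * (50 + 20 * codes) + 20 \<le> 200 * (codes * codes)"
    using codes_square unfolding mult.left_commute[of codes 90] by linarith
  show ?thesis
    unfolding leaf_prog_def
  proof (rule runs_For[where I = ?I and n = "20 * codes + 40" and h = "num_teams T + 1"], goal_cases)
    case (6 u m')
    have n: "nat_mem m' ''n'' [] = codes" using 6(5)[of "''n''"] m by simp
    have "runs (For ''c'' 0 (Var ''n'') (RPut ''F'' [NConst 0, Var ''u'', Var ''c''] (ROfNat (NConst 0))))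
        m' (20 * codes + 20) (\<lambda>m''. ?I u m'' \<and> (\<forall>c<codes. real_mem m'' ''F'' [0, u, c] = 0) \<and> nat_mem m'' ''u'' [] = u)"
      by (rule runs_For[where I = "\<lambda>c m''. ?I u m'' \<and> (\<forall>c'<c. real_mem m'' ''F'' [0, u, c'] = 0)"
            and n = 8 and h = codes])
         (use 6(1-4) n in \<open>auto simp: runs_simps less_Suc_eq\<close>)
    then show ?case
      by (rule runs_Seq[OF runs_frame[where l = "20 * codes + 20"], where k = 20])
         (auto simp: runs_simps less_Suc_eq)
  qed (use cost m table in auto)
qed

lemma runs_points_prog:
  assumes "ready m" "g \<in> level (Suc k)" "u \<in> teams T"
    and "nat_mem m ''k'' [] = k" "nat_mem m ''g'' [] = g" "nat_mem m ''u'' [] = u"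
  shows "runs points_prog m (200 * codes) (\<lambda>m'. nat_mem m' ''x'' [] = points g u)"
proof -
  let ?s = "\<lambda>i. \<Sum>i'<i. E (Suc i') u g * base ^ i'"
  have g: "g \<in> games T" "game_round T g = Suc k" using assms(2) by (auto simp: level_Suc)
  have m: "nat_mem m ''entries'' [] = e" "\<And>i. i < e \<Longrightarrow> nat_mem m ''pw'' [i] = base ^ i"
    "\<And>i. i < e \<Longrightarrow> nat_mem m ''E'' [Suc i, u, g] = E (Suc i) u g"
    using assms(1,3) g by (auto simp: ready_def inputD)
  have k: "k \<le> codes"
    using level_range[of "Suc k"] assms(2) size_bounds(3) by (cases "Suc k \<le> rounds T") auto
  have points: "2 ^ k * ?s e = points g u"
    by (simp add: points_def g sum_distrib_left mult.assoc)
  have entries: "runs (For ''i'' 0 (Var ''entries'')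
       (Cond (NLess (NConst 0) (NGet ''E'' [NAdd (Var ''i'') (NConst 1), Var ''u'', Var ''g'']))
          (NPut ''x'' [] (NAdd (Var ''x'') (NGet ''pw'' [Var ''i'']))) Skip))
     (nat_store ''x'' [] 0 m) (50 * e + 20) (\<lambda>m'. nat_mem m' ''x'' [] = ?s e \<and> nat_mem m' ''k'' [] = k)"
  proof (rule runs_For[where I = "\<lambda>i m'. nat_mem m' ''x'' [] = ?s i" and n = 30 and h = e], goal_cases)
    case (6 i m')
    have "nat_mem m' ''pw'' [i] = base ^ i" "nat_mem m' ''E'' [Suc i, u, g] = E (Suc i) u g"
      using 6(2) m 6(5)[of "''pw''"] 6(5)[of "''E''"] by simp_all
    moreover have "nat_mem m' ''u'' [] = u" "nat_mem m' ''g'' [] = g"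
      using assms 6(5)[of "''u''"] 6(5)[of "''g''"] by simp_all
    moreover have "E (Suc i) u g = 0 \<or> E (Suc i) u g = 1"
      using entry_le_1[OF 6(2), of u g] by auto
    ultimately show ?case using 6(3,4) by (auto simp: runs_simps)
  qed (use assms m in auto)
  have double: "runs (For ''j'' 0 (Var ''k'') (NPut ''x'' [] (NAdd (Var ''x'') (Var ''x'')))) m'
      (30 * k + 20) (\<lambda>m'. nat_mem m' ''x'' [] = points g u)"
    if "nat_mem m' ''x'' [] = ?s e" "nat_mem m' ''k'' [] = k" for m'
    unfolding points[symmetric]
    by (rule runs_For[where I = "\<lambda>j m'. nat_mem m' ''x'' [] = 2 ^ j * ?s e" and n = 10 and h = k])
       (use that in \<open>auto simp: runs_simps\<close>)
  have "runs (Seq (For ''i'' 0 (Var ''entries'')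
       (Cond (NLess (NConst 0) (NGet ''E'' [NAdd (Var ''i'') (NConst 1), Var ''u'', Var ''g'']))
          (NPut ''x'' [] (NAdd (Var ''x'') (NGet ''pw'' [Var ''i'']))) Skip))
      (For ''j'' 0 (Var ''k'') (NPut ''x'' [] (NAdd (Var ''x'') (Var ''x'')))))
     (nat_store ''x'' [] 0 m) (50 * e + 20 + (30 * k + 20)) (\<lambda>m'. nat_mem m' ''x'' [] = points g u)"
  proof (rule runs_Seq[where n = "50 * e + 20" and k = "30 * k + 20"], goal_cases)
    case 1
    show ?case by (rule runs_frame[OF entries]) (simp_all add: double)
  qed simp
  then show ?thesis
    unfolding points_prog_def using size_bounds k by (auto simp: runs_Seq_put intro: runs_weaken)
qed

lemma opponent_iff:
  assumes g: "g \<in> level (Suc k)" and h: "feeders g = {h, h'}" "h \<noteq> h'" and u: "u \<in> contestants k h"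
  shows "v \<in> game_teams T g \<and> (k < 1 \<and> u \<noteq> v \<or> 0 < k \<and> predecessor_of T g u \<noteq> predecessor_of T g v)
    \<longleftrightarrow> v \<in> contestants k h'"
proof -
  have "h \<in> level k" "h' \<in> level k" using feeders_subset[OF g] h by auto
  then have disj: "contestants k h \<inter> contestants k h' = {}"
    using disjoint_family_onD[OF disjoint_contestants] h by blast
  have union: "game_teams T g = contestants k h \<union> contestants k h'"
    using game_teams_feeders[OF g] h by simp
  show ?thesis
  proof (cases "k = 0")
    case True
    then show ?thesis using union u h by (auto simp: contestants_def)
  next
    case False
    then have "predecessor_of T g x = h" if "x \<in> contestants k h" for x
      using predecessor_of_eq[OF g _ _ that] h by simp
    moreover have "predecessor_of T g x = h'" if "x \<in> contestants k h'" for x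
      using predecessor_of_eq[OF g _ _ that] h False by simp
    ultimately show ?thesis using False union disj u h by auto
  qed
qed

lemma runs_opponent_prog:
  assumes "ready m" "table k m" and g: "g \<in> level (Suc k)"
    and h: "feeders g = {h, h'}" "h \<noteq> h'" and u: "u \<in> contestants k h" and d: "d < codes"
    and vars: "nat_mem m ''k'' [] = k" "nat_mem m ''g'' [] = g" "nat_mem m ''u'' [] = u" "nat_mem m ''d'' [] = d"
  shows "runs opponent_prog m (200 * codes)
    (\<lambda>m'. real_mem m' ''y'' [] = (\<Sum>v\<in>contestants k h'. P u v * pmf (law k h') (v, d)))"
proof -
  have hl: "h \<in> level k" "h' \<in> level k" using feeders_subset[OF g] h by auto
  have teams: "contestants k h' \<subseteq> {1..num_teams T}" "u \<in> teams T"
    using contestants_teams[OF hl(1)] contestants_teams[OF hl(2)] u by (auto simp: teams_def)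
  have m: "nat_mem m ''teams'' [] = num_teams T" using assms(1) by (auto simp: ready_def inputD)
  let ?t = "\<lambda>v. P u v * pmf (law k h') (v, d)"
  let ?I = "\<lambda>j m'. real_mem m' ''y'' [] = (\<Sum>v\<in>contestants k h' \<inter> {1..<j}. ?t v)"
  have "runs (For ''v'' 1 (NAdd (Var ''teams'') (NConst 1))
       (Cond opponent_exp
          (RPut ''y'' [] (RAdd (RGet ''y'' [])
             (RMul (RGet ''P'' [Var ''u'', Var ''v'']) (RGet ''F'' [Var ''k'', Var ''v'', Var ''d'']))))
          Skip)) (real_store ''y'' [] 0 m) (150 * num_teams T + 20)
     (\<lambda>m'. real_mem m' ''y'' [] = (\<Sum>v\<in>contestants k h'. ?t v))"
  proof (rule runs_For[where I = ?I and n = 120 and h = "num_teams T + 1"], goal_cases)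
    case (6 v m')
    have v: "v \<in> teams T" using 6(1,2) by (simp add: teams_def)
    have "ready m'"
      by (rule ready_frame[OF assms(1)]) (use 6(5,6) in simp_all)
    then have input: "input m'" by (simp add: ready_def)
    have vars': "nat_mem m' ''k'' [] = k" "nat_mem m' ''g'' [] = g" "nat_mem m' ''u'' [] = u" "nat_mem m' ''d'' [] = d"
      using vars 6(5) by simp_all
    have gg: "g \<in> games T" "game_round T g = Suc k" using g by (auto simp: level_Suc)
    have "u \<in> game_teams T g" using game_teams_feeders[OF g] h u by auto
    \<comment> \<open>If \<open>v\<close> does not play in \<open>g\<close>, its \<open>pred\<close>
      cell is unspecified, but then the first conjunct of the test fails already.\<close>
    then have cond: "bval m' opponent_exp \<longleftrightarrow> v \<in> contestants k h'"
      using opponent_iff[OF g h u, of v] v teams gg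
      by (cases "v \<in> game_teams T g") (auto simp: opponent_exp_def vars' 6(4) inputD[OF input])
    have "real_mem m' ''F'' = real_mem m ''F''" using 6(6)[of "''F''"] by simp
    then have F: "real_mem m' ''F'' [k, v, d] = pmf (law k h') (v, d)" if "v \<in> contestants k h'"
      using assms(2) that d hl by (simp add: table_def)
    have Pv: "real_mem m' ''P'' [u, v] = P u v" using inputD(7)[OF input teams(2) v] .
    have bc: "bcost opponent_exp \<le> 80" by (simp add: opponent_exp_def)
    show ?case
    proof (cases "v \<in> contestants k h'")
      case True
      then have "contestants k h' \<inter> {1..<Suc v} = insert v (contestants k h' \<inter> {1..<v})"
        using 6(1) by auto
      then show ?thesis
        using True cond F Pv bc 6(3,4) vars' by (simp add: runs_simps)
    next
      case False
      then have "contestants k h' \<inter> {1..<Suc v} = contestants k h' \<inter> {1..<v}"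
        by (auto simp: less_Suc_eq)
      then show ?thesis using False cond bc 6(3) by (simp add: runs_simps)
    qed
  next
    case (8 m')
    have "contestants k h' \<inter> {1..<num_teams T + 1} = contestants k h'" using teams by auto
    then show ?case using 8(1) by simp
  qed (use m in auto)
  then show ?thesis
    unfolding opponent_prog_def using size_bounds by (auto simp: runs_Seq_put intro: runs_weaken)
qed

lemma runs_convolution_prog:
  assumes ready: "ready m" and table: "table k m" and g: "g \<in> level (Suc k)"
    and h: "feeders g = {h, h'}" "h \<noteq> h'" and u: "u \<in> contestants k h"
    and vars: "nat_mem m ''k'' [] = k" "nat_mem m ''g'' [] = g" "nat_mem m ''u'' [] = u"
      "nat_mem m ''x'' [] = points g u"
  shows "runs convolution_prog m (600 * (codes * codes))
    (\<lambda>m'. (\<forall>c<codes. real_mem m' ''F'' [Suc k, u, c] = pmf (law (Suc k) g) (u, c)) \<and>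
      (\<forall>is. (\<forall>c. is \<noteq> [Suc k, u, c]) \<longrightarrow> real_mem m' ''F'' is = real_mem m ''F'' is))"
proof -
  define f where "f a = pmf (law k h) (u, a)" for a
  define y where "y d = (\<Sum>v\<in>contestants k h'. P u v * pmf (law k h') (v, d))" for d
  define t where "t a d c = (if a + d + points g u = c then f a * y d else 0)" for a d c
  \<comment> \<open>The whole row of \<open>u\<close> is exempt, including columns from
    \<open>codes\<close> on, since the index \<open>a + d + points g u\<close> can leave the range.
    It cannot leave the row.\<close>
  define other where "other m' \<longleftrightarrow> (\<forall>is. (\<forall>c. is \<noteq> [Suc k, u, c]) \<longrightarrow> real_mem m' ''F'' is = real_mem m ''F'' is)"
    for m' :: memory
  have hl: "h \<in> level k" using feeders_subset[OF g] h by auto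
  \<comment> \<open>The order of summation is swapped because the program has \<open>d\<close> in
    the outer loop: the opponent sum \<open>y d\<close> is then computed once for all
    \<open>a\<close>.\<close>
  have total: "pmf (law (Suc k) g) (u, c) = (\<Sum>d<codes. \<Sum>a<codes. t a d c)" for c
    unfolding pmf_law_Suc[OF g h u] t_def f_def y_def by (rule sum.swap)
  have table_other: "table k m'" if "other m'" for m'
    using table that by (auto simp: table_def other_def)
  have F_other: "real_mem m' ''F'' [k, u, a] = f a" if "other m'" "a < codes" for m' a
    using table_other[OF that(1)] that(2) hl u by (auto simp: table_def f_def)
  have other_store [simp]: "other (nat_store x is a m') = other m'" for x "is" a m'
    by (simp add: other_def)
  have other_y [simp]: "other (real_store ''F'' [Suc k, u, c] a m')" if "other m'" for c a m'
    using that by (auto simp: other_def)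
  have n: "nat_mem m ''n'' [] = codes" using ready by (simp add: ready_def)
  have zero: "runs (For ''c'' 0 (Var ''n'')
        (RPut ''F'' [NAdd (Var ''k'') (NConst 1), Var ''u'', Var ''c''] (ROfNat (NConst 0))))
      m (100 * codes) (\<lambda>m'. other m' \<and> (\<forall>c<codes. real_mem m' ''F'' [Suc k, u, c] = 0))"
  proof (rule runs_For[where I = "\<lambda>c m'. other m' \<and> (\<forall>c'<c. real_mem m' ''F'' [Suc k, u, c'] = 0)"
        and n = 20 and h = codes], goal_cases)
    case (6 c m')
    have "nat_mem m' ''k'' [] = k" "nat_mem m' ''u'' [] = u" using 6(5) vars by simp_all
    with 6(3,4) show ?case by (auto simp: runs_simps less_Suc_eq)
  qed (use n size_bounds(5) in \<open>auto simp: other_def\<close>)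
  let ?a_loop = "For ''a'' 0 (Var ''n'')
          (RPut ''F'' [NAdd (Var ''k'') (NConst 1), Var ''u'', NAdd (NAdd (Var ''a'') (Var ''d'')) (Var ''x'')]
             (RAdd (RGet ''F'' [NAdd (Var ''k'') (NConst 1), Var ''u'', NAdd (NAdd (Var ''a'') (Var ''d'')) (Var ''x'')])
                (RMul (RGet ''F'' [Var ''k'', Var ''u'', Var ''a'']) (RGet ''y'' []))))"
  let ?I = "\<lambda>d m'. other m' \<and> (\<forall>c<codes. real_mem m' ''F'' [Suc k, u, c] = (\<Sum>d'<d. \<Sum>a<codes. t a d' c))"
  have inner: "runs ?a_loop m' (100 * codes) (?I (Suc d))"
    if "?I d m'" and m': "nat_mem m' ''n'' [] = codes" "nat_mem m' ''k'' [] = k" "nat_mem m' ''u'' [] = u"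
      "nat_mem m' ''x'' [] = points g u" "nat_mem m' ''d'' [] = d" "real_mem m' ''y'' [] = y d" for d m'
  proof (rule runs_For[where I = "\<lambda>a m''. other m'' \<and> (\<forall>c<codes. real_mem m'' ''F'' [Suc k, u, c] =
        (\<Sum>d'<d. \<Sum>a<codes. t a d' c) + (\<Sum>a'<a. t a' d c))" and n = 60 and h = codes], goal_cases)
    case (6 a m'')
    have "nat_mem m'' ''k'' [] = k" "nat_mem m'' ''u'' [] = u" "nat_mem m'' ''x'' [] = points g u"
      "nat_mem m'' ''d'' [] = d" "real_mem m'' ''y'' [] = y d"
      using 6(5,6) m' by simp_all
    moreover have "real_mem m'' ''F'' [k, u, a] = f a" using 6(2,3) F_other by blast
    ultimately show ?case
      using 6(3,4) by (auto simp: runs_simps t_def algebra_simps)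
  qed (use that size_bounds(5) in auto)
  have outer: "runs (For ''d'' 0 (Var ''n'') (Seq opponent_prog ?a_loop)) m1 (500 * (codes * codes)) (?I codes)"
    if m1: "other m1" "\<forall>c<codes. real_mem m1 ''F'' [Suc k, u, c] = 0" "ready m1"
      "nat_mem m1 ''k'' [] = k" "nat_mem m1 ''g'' [] = g" "nat_mem m1 ''u'' [] = u"
      "nat_mem m1 ''x'' [] = points g u" for m1
  proof (rule runs_For[where I = ?I and n = "300 * codes" and h = codes], goal_cases)
    case (6 d m')
    have ready': "ready m'"
      by (rule ready_frame[OF m1(3)]) (use 6(5,6) in simp_all)
    have vars': "nat_mem m' ''k'' [] = k" "nat_mem m' ''g'' [] = g" "nat_mem m' ''u'' [] = u"
      "nat_mem m' ''x'' [] = points g u" "nat_mem m' ''n'' [] = codes"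
      using 6(5) m1(4-) ready' by (simp_all add: ready_def)
    have "runs opponent_prog m' (200 * codes) (\<lambda>m''. real_mem m'' ''y'' [] = y d)"
      unfolding y_def using 6(2-4) vars'
      by (intro runs_opponent_prog[OF ready' table_other g h u]) auto
    then show ?case
    proof (rule runs_Seq[OF runs_frame[where l = "200 * codes"], where k = "100 * codes"], goal_cases)
      case (1 m'')
      have F: "real_mem m'' ''F'' = real_mem m' ''F''" using 1(3)[of "''F''"] by simp
      then have "other m''" using 6(3) by (simp add: other_def)
      with F 6(3,4) 1 vars' show ?case by (intro inner) auto
    qed auto
  next
    case 7
    show ?case
      by (rule order.trans[OF loop_cost[where K = 300 and M = codes]])
         (use size_bounds(5) in auto)
  qed (use that in \<open>auto simp: ready_def\<close>)
  have "runs (Seq (For ''c'' 0 (Var ''n'')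
        (RPut ''F'' [NAdd (Var ''k'') (NConst 1), Var ''u'', Var ''c''] (ROfNat (NConst 0))))
      (For ''d'' 0 (Var ''n'') (Seq opponent_prog ?a_loop))) m (600 * (codes * codes)) (?I codes)"
  proof (rule runs_Seq[where n = "100 * codes" and k = "500 * (codes * codes)"])
    show "runs (For ''c'' 0 (Var ''n'')
        (RPut ''F'' [NAdd (Var ''k'') (NConst 1), Var ''u'', Var ''c''] (ROfNat (NConst 0))))
      m (100 * codes) (\<lambda>m1. runs (For ''d'' 0 (Var ''n'') (Seq opponent_prog ?a_loop)) m1 (500 * (codes * codes)) (?I codes))"
    proof (rule runs_frame[OF zero], goal_cases)
      case (1 m1)
      show ?case
      proof (rule outer)
        show "ready m1" by (rule ready_frame[OF ready]) (use 1(2,3) in simp_all)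
      qed (use 1 vars in auto)
    qed simp
    show "100 * codes + 500 * (codes * codes) \<le> 600 * (codes * codes)"
      using codes_square(2) by linarith
  qed
  then show ?thesis
    unfolding convolution_prog_def total other_def by (simp only: conj_commute)
qed

lemma feedersE_contestant:
  assumes "g \<in> level (Suc k)" "u \<in> game_teams T g"
  obtains h h' where "feeders g = {h, h'}" "h \<noteq> h'" "u \<in> contestants k h"
proof -
  obtain x y where xy: "feeders g = {x, y}" "x \<noteq> y" using feedersE[OF assms(1)] .
  then have "u \<in> contestants k x \<or> u \<in> contestants k y"
    using game_teams_feeders[OF assms(1)] assms(2) by auto
  with xy that[of x y] that[of y x] show ?thesis by auto
qed

text \<open>The common invariant of the loops over games and teams, which scan pairs
  lexicographically: a finished row of teams for \<open>g\<close> amounts to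
  \<open>filled k (Suc g) 1\<close>.\<close>

definition filled :: "nat \<Rightarrow> nat \<Rightarrow> nat \<Rightarrow> memory \<Rightarrow> bool" where
  "filled k g u m \<longleftrightarrow> (\<forall>g'\<in>level (Suc k). \<forall>v\<in>game_teams T g'. g' < g \<or> g' = g \<and> v < u \<longrightarrow>
     (\<forall>c<codes. real_mem m ''F'' [Suc k, v, c] = pmf (law (Suc k) g') (v, c)))"

lemma table_filled_store [simp]:
  "table k (nat_store x is a m) = table k m" "filled k g u (nat_store x is a m) = filled k g u m"
  by (simp_all add: table_def filled_def)

lemma table_filled_cong:
  assumes "real_mem m' ''F'' = real_mem m ''F''"
  shows "table k m' = table k m" "filled k g u m' = filled k g u m"
  using assms by (simp_all add: table_def filled_def)

lemma runs_cell:
  assumes ready: "ready m" and table: "table k m" and filled: "filled k g u m"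
    and g: "g \<in> games T" and u: "u \<in> teams T"
    and vars: "nat_mem m ''k'' [] = k" "nat_mem m ''g'' [] = g" "nat_mem m ''u'' [] = u"
  shows "runs (Cond (BAnd (eq_exp (NGet ''round'' [Var ''g'']) (NAdd (Var ''k'') (NConst 1)))
                (eq_exp (NGet ''plays'' [Var ''g'', Var ''u'']) (NConst 1)))
          (Seq points_prog convolution_prog) Skip) m (900 * (codes * codes))
     (\<lambda>m'. table k m' \<and> filled k g (Suc u) m')"
proof (rule runs_Cond[where n = "800 * (codes * codes)"], goal_cases)
  case 1
  have "input m" using ready by (simp add: ready_def)
  with 1 vars have gu: "g \<in> level (Suc k)" "u \<in> game_teams T g"
    using g u by (auto simp: inputD level_Suc split: if_splits)
  obtain h h' where h: "feeders g = {h, h'}" "h \<noteq> h'" "u \<in> contestants k h"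
    using feedersE_contestant[OF gu] .
  show ?case
  proof (rule runs_Seq[where n = "200 * codes" and k = "600 * (codes * codes)"],
      rule runs_frame[OF runs_points_prog[OF ready gu(1) u vars]], goal_cases)
    case (1 m')
    have "real_mem m' ''F'' = real_mem m ''F''" using 1(3)[of "''F''"] by simp
    note [simp] = table_filled_cong[OF this]
    have "ready m'" by (rule ready_frame[OF ready]) (use 1(2,3) in simp_all)
    note conv = runs_convolution_prog[OF this _ gu(1) h]
    show ?case
    proof (rule runs_frame[OF conv], goal_cases)
      case (6 m'')
      \<comment> \<open>Level \<open>k\<close> is only read and level \<open>Suc k\<close> only
        written, in the row of \<open>u\<close>; so \<open>table k\<close> and the rows of other
        teams survive.\<close>
      have keep: "real_mem m'' ''F'' [k', v, c] = real_mem m' ''F'' [k', v, c]" if "k' \<noteq> Suc k \<or> v \<noteq> u" for k' v c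
      proof -
        have "\<forall>c'. [k', v, c] \<noteq> [Suc k, u, c']" using that by auto
        then show ?thesis using 6(1) by blast
      qed
      have "table k m''"
        using table by (simp add: table_def keep \<open>real_mem m' ''F'' = real_mem m ''F''\<close>)
      moreover have "filled k g (Suc u) m''"
        unfolding filled_def
      proof (intro ballI impI allI)
        fix g' v c
        assume g': "g' \<in> level (Suc k)" "v \<in> game_teams T g'" "g' < g \<or> g' = g \<and> v < Suc u" "c < codes"
        show "real_mem m'' ''F'' [Suc k, v, c] = pmf (law (Suc k) g') (v, c)"
        proof (cases "v = u")
          case True
          \<comment> \<open>Omitting the game from the index of \<open>F\<close> is safe here: a
            team plays only one game of a round, so no earlier game of this round has used the row
            of \<open>u\<close>.\<close>
          then have "g' = g"
            using disjoint_family_onD[OF disjoint_contestants[of "Suc k"] g'(1) gu(1)] g'(2) gu(2) by auto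
          with True 6(1) g'(4) show ?thesis by simp
        next
          case False
          then show ?thesis
            using filled g' by (auto simp: keep filled_def \<open>real_mem m' ''F'' = real_mem m ''F''\<close> less_Suc_eq)
        qed
      qed
      ultimately show ?case by simp
    qed (use 1 table vars in auto)
  next
    case 3
    then show ?case using codes_square by simp
  qed simp
next
  case 2
  have "input m" using ready by (simp add: ready_def)
  with 2 vars have "\<not> (g \<in> level (Suc k) \<and> u \<in> game_teams T g)"
    using g u by (auto simp: inputD level_Suc)
  then have "filled k g (Suc u) m"
    using filled unfolding filled_def by (auto simp: less_Suc_eq)
  then show ?case using table size_bounds(5) by (simp add: runs_simps)
next
  case 3
  show ?case by simp (use codes_square(1) in linarith)
qed

lemma runs_rounds_prog:
  assumes ready: "ready m" and table: "table 0 m"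
  shows "runs rounds_prog m (1200 * (rounds T * (num_teams T * (num_teams T * (codes * codes)))))
    (table (rounds T))"
proof -
  let ?N = "codes * codes" and ?t = "num_teams T"
  let ?cell = "Cond (BAnd (eq_exp (NGet ''round'' [Var ''g'']) (NAdd (Var ''k'') (NConst 1)))
                (eq_exp (NGet ''plays'' [Var ''g'', Var ''u'']) (NConst 1)))
          (Seq points_prog convolution_prog) Skip"
  let ?row = "For ''u'' 1 (NAdd (Var ''teams'') (NConst 1)) ?cell"
  have t: "1 \<le> ?t" by (simp add: num_teams_def)
  have t': "\<And>m'. ready m' \<Longrightarrow> nat_mem m' ''teams'' [] = ?t" by (simp add: ready_def inputD)
  have row: "runs ?row m' (1000 * (?t * ?N)) (\<lambda>m'. table k m' \<and> filled k (Suc g) 1 m')"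
    if m': "ready m'" "table k m'" "filled k g 1 m'" "g \<in> games T"
      "nat_mem m' ''k'' [] = k" "nat_mem m' ''g'' [] = g" for k g m'
  proof (rule runs_For[where I = "\<lambda>u m'. table k m' \<and> filled k g u m'" and n = "900 * ?N" and h = "?t + 1"], goal_cases)
    case (6 u m'')
    have "ready m''" by (rule ready_frame[OF m'(1)]) (use 6(5,6) in simp_all)
    moreover have "u \<in> teams T" using 6(1,2) by (simp add: teams_def)
    moreover have "nat_mem m'' ''k'' [] = k" "nat_mem m'' ''g'' [] = g"
      using 6(5) m'(5,6) by simp_all
    ultimately show ?case using 6(3,4) m'(4) by (intro runs_cell) simp_all
  next
    case 7
    have "?t * (900 * ?N + 10) + 10 \<le> 1000 * (?t * ?N)"
    proof -
      have "?t * 1 \<le> ?t * ?N" "1 * 1 \<le> ?t * ?N" using t codes_square by (auto intro!: mult_le_mono)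
      then show ?thesis by (simp only: distrib_left mult.left_commute[of _ 900])
    qed
    then show ?case by (simp add: add.commute)
  next
    case (8 m'')
    then show ?case
      using contestants_teams[of _ "Suc k"] by (fastforce simp: filled_def teams_def less_Suc_eq)
  qed (use m' t' in auto)
  have column: "runs (For ''g'' 1 (Var ''teams'') ?row) m' (1100 * (?t * (?t * ?N))) (table (Suc k))"
    if m': "ready m'" "table k m'" "nat_mem m' ''k'' [] = k" for k m'
  proof (rule runs_For[where I = "\<lambda>g m'. table k m' \<and> filled k g 1 m'" and n = "1000 * (?t * ?N)" and h = ?t], goal_cases)
    case (6 g m'')
    have "ready m''" by (rule ready_frame[OF m'(1)]) (use 6(5,6) in simp_all)
    moreover have "g \<in> games T" using 6(1,2) by (simp add: games_def)
    moreover have "nat_mem m'' ''k'' [] = k" using 6(5) m'(3) by simp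
    ultimately show ?case using 6(3,4) by (intro row) simp_all
  next
    case 7
    show ?case
      by (rule order.trans[OF loop_cost[where K = 1000 and M = "?t * ?N"]])
         (use t codes_square in \<open>auto simp: mult_le_mono\<close>)
  next
    case (8 m'')
    \<comment> \<open>The games are numbered up to \<open>?t - 1\<close>, so reaching the bound
      \<open>?t\<close> means that all of them are done.\<close>
    have "table k m'' \<Longrightarrow> filled k ?t 1 m'' \<Longrightarrow> table (Suc k) m''"
      using level_Suc[of _ k] t by (fastforce simp: filled_def table_def games_def)
    with 8(1) show ?case by simp
  next
    case 5
    \<comment> \<open>Vacuous, because games and teams are numbered from 1.\<close>
    have "filled k 1 1 m'"
      using level_Suc contestants_teams[of _ "Suc k"] by (fastforce simp: filled_def games_def teams_def)
    then show ?case using m' by simp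
  qed (use m' t t' in auto)
  show ?thesis
    unfolding rounds_prog_def
  proof (rule runs_For[where I = table and n = "1100 * (?t * (?t * ?N))" and h = "rounds T"], goal_cases)
    case (6 k m')
    have "ready m'" by (rule ready_frame[OF ready]) (use 6(5,6) in simp_all)
    then show ?case using 6(3,4) by (intro column)
  next
    case 7
    have "1 \<le> ?t * (?t * ?N)" using t codes_square by simp
    then show ?case
      by (intro order.trans[OF loop_cost[where K = 1100 and M = "?t * (?t * ?N)"]])
         (use rounds_pos in auto)
  next
    case (1 m')
    then show ?case using ready by (simp add: ready_def inputD)
  qed (use table in auto)
qed

lemma runs_sum_prog:
  assumes ready: "ready m" and table: "table (rounds T) m"
  shows "runs sum_prog m (300 * (codes * codes))
    (\<lambda>m'. real_mem m' ''result'' [] = expected_max_score T P (E ` {1..e}))"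
proof -
  let ?t = "\<lambda>u c. pmf (law (rounds T) final) (u, c) * real (max_digit base c)"
  let ?I = "\<lambda>u m'. real_mem m' ''result'' [] = (\<Sum>v\<in>{1..<u}. \<Sum>c<codes. ?t v c)"
  let ?row = "For ''c'' 0 (Var ''n'') (RPut ''result'' [] (RAdd (RGet ''result'' [])
           (RMul (RGet ''F'' [Var ''rounds'', Var ''u'', Var ''c'']) (ROfNat (NGet ''mx'' [Var ''c''])))))"
  have F: "real_mem m ''F'' [rounds T, u, c] = pmf (law (rounds T) final) (u, c)" if "u \<in> teams T" "c < codes" for u c
    using table Union_contestants[of "rounds T"] that by (simp add: table_def level_rounds)
  have m: "nat_mem m ''n'' [] = codes" "nat_mem m ''teams'' [] = num_teams T" "nat_mem m ''rounds'' [] = rounds T"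
    "\<And>c. c < codes \<Longrightarrow> nat_mem m ''mx'' [c] = max_digit base c"
    using ready by (simp_all add: ready_def inputD)
  have "runs (For ''u'' 1 (NAdd (Var ''teams'') (NConst 1)) ?row) (real_store ''result'' [] 0 m)
      (200 * (codes * codes)) (?I (num_teams T + 1))"
  proof (rule runs_For[where I = ?I and n = "50 * codes" and h = "num_teams T + 1"], goal_cases)
    case (6 u m')
    note outer = this
    have "u \<in> teams T" using 6(1,2) by (simp add: teams_def)
    have "runs ?row m' (50 * codes) (\<lambda>m''. real_mem m'' ''result'' [] =
        (\<Sum>v\<in>{1..<u}. \<Sum>c<codes. ?t v c) + (\<Sum>c<codes. ?t u c))"
    proof (rule runs_For[where I = "\<lambda>c m''. real_mem m'' ''result'' [] =
        (\<Sum>v\<in>{1..<u}. \<Sum>c<codes. ?t v c) + (\<Sum>c'<c. ?t u c')" and n = 18 and h = codes], goal_cases)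
      case (6 c m'')
      have "real_mem m'' ''F'' [rounds T, u, c] = pmf (law (rounds T) final) (u, c)"
        using F[OF \<open>u \<in> teams T\<close> 6(2)] 6(6)[of "''F''"] outer(6)[of "''F''"]
        by simp
      moreover have "nat_mem m'' ''mx'' [c] = max_digit base c" "nat_mem m'' ''rounds'' [] = rounds T"
        "nat_mem m'' ''u'' [] = u"
        using m(3) m(4)[OF 6(2)] 6(5) outer(4,5) by simp_all
      ultimately show ?case using 6(3,4) by (simp add: runs_simps)
    qed (use 6 m size_bounds(5) in auto)
    then show ?case
      by (rule runs_frame) (use 6(1) in simp_all)
  next
    case 7
    have "num_teams T * (10 + 50 * codes) \<le> codes * (60 * codes)"
      using size_bounds by (intro mult_le_mono) auto
    then have "10 + num_teams T * (10 + 50 * codes) \<le> 200 * (codes * codes)"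
      using codes_square unfolding mult.left_commute[of codes 60] by linarith
    then show ?case by (simp add: add.commute)
  qed (use m in auto)
  then have "runs (For ''u'' 1 (NAdd (Var ''teams'') (NConst 1)) ?row) (real_store ''result'' [] 0 m)
      (200 * (codes * codes)) (\<lambda>m'. real_mem m' ''result'' [] = expected_max_score T P (E ` {1..e}))"
    unfolding expected_max_score_eq by (simp add: teams_def atLeastLessThanSuc_atLeastAtMost)
  moreover have "3 + 200 * (codes * codes) \<le> 300 * (codes * codes)"
    using codes_square(1) by linarith
  ultimately show ?thesis
    unfolding sum_prog_def
    by (intro runs_Seq[where n = 3 and k = "200 * (codes * codes)"] runs_RPut) simp_all
qed

lemma runs_program:
  assumes "input m"
  shows "runs program m (2500 * (rounds T * (num_teams T * (num_teams T * (codes * codes)))))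
    (\<lambda>m'. real_mem m' ''result'' [] = expected_max_score T P (E ` {1..e}))"
proof -
  let ?N = "codes * codes"
  let ?M = "rounds T * (num_teams T * (num_teams T * ?N))"
  have ready: "input m' \<Longrightarrow> nat_mem m' ''n'' [] = codes \<Longrightarrow> \<forall>i<e. nat_mem m' ''pw'' [i] = base ^ i \<Longrightarrow>
      \<forall>c<codes. nat_mem m' ''mx'' [c] = max_digit base c \<Longrightarrow> ready m'" for m'
    by (simp add: ready_def)
  have input: "input m'" if "input m1" "\<And>x. x \<notin> {''b'', ''j'', ''n'', ''i'', ''pw'', ''x'', ''q'', ''d'', ''mx'', ''c''} \<Longrightarrow> nat_mem m' x = nat_mem m1 x"
    "\<And>x. x \<notin> {} \<Longrightarrow> real_mem m' x = real_mem m1 x" for m1 m'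
    using that(1) by (simp add: input_def holds_input_def that(2,3))
  have sum: "runs sum_prog m' (300 * ?N) (\<lambda>m'. real_mem m' ''result'' [] = expected_max_score T P (E ` {1..e}))"
    if "ready m'" "table (rounds T) m'" for m'
    using that by (rule runs_sum_prog)
  have rounds: "runs (Seq rounds_prog sum_prog) m' (1200 * ?M + 300 * ?N)
      (\<lambda>m'. real_mem m' ''result'' [] = expected_max_score T P (E ` {1..e}))"
    if "ready m'" "table 0 m'" for m'
  proof (rule runs_Seq[where n = "1200 * ?M" and k = "300 * ?N"], rule runs_frame[OF runs_rounds_prog[OF that]], goal_cases)
    case (1 m'')
    have "ready m''" by (rule ready_frame[OF that(1)]) (use 1(2,3) in \<open>simp_all add: rounds_prog_def\<close>)
    then show ?case using 1(1) by (rule sum)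
  qed simp_all
  have leaf: "runs (Seq leaf_prog (Seq rounds_prog sum_prog)) m' (200 * ?N + (1200 * ?M + 300 * ?N))
      (\<lambda>m'. real_mem m' ''result'' [] = expected_max_score T P (E ` {1..e}))"
    if "ready m'" for m'
  proof (rule runs_Seq[where n = "200 * ?N" and k = "1200 * ?M + 300 * ?N"], rule runs_frame[OF runs_leaf_prog[OF that]], goal_cases)
    case (1 m'')
    have "ready m''" by (rule ready_frame[OF that(1)]) (use 1(2,3) in \<open>simp_all add: leaf_prog_def\<close>)
    then show ?case using 1(1) by (rule rounds)
  qed simp_all
  have digit: "runs (Seq digit_prog (Seq leaf_prog (Seq rounds_prog sum_prog))) m' (100 * codes + (200 * ?N + (1200 * ?M + 300 * ?N)))
      (\<lambda>m'. real_mem m' ''result'' [] = expected_max_score T P (E ` {1..e}))"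
    if m': "input m'" "nat_mem m' ''b'' [] = base" "nat_mem m' ''n'' [] = codes" "\<forall>i<e. nat_mem m' ''pw'' [i] = base ^ i" for m'
  proof (rule runs_Seq[where n = "100 * codes" and k = "200 * ?N + (1200 * ?M + 300 * ?N)"],
      rule runs_frame[OF runs_digit_prog[OF m'(2,3)]], goal_cases)
    case (1 m'')
    have "input m''" by (rule input[OF m'(1)]) (use 1(2,3) in \<open>simp_all add: digit_prog_def\<close>)
    moreover have "nat_mem m'' ''n'' [] = codes" "\<forall>i<e. nat_mem m'' ''pw'' [i] = base ^ i"
      using 1(2) m'(3,4) by (simp_all add: digit_prog_def)
    ultimately show ?case using 1(1) by (intro leaf ready)
  qed simp_all
  have power: "runs (Seq power_prog (Seq digit_prog (Seq leaf_prog (Seq rounds_prog sum_prog)))) m'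
      (200 * ?N + (100 * codes + (200 * ?N + (1200 * ?M + 300 * ?N))))
      (\<lambda>m'. real_mem m' ''result'' [] = expected_max_score T P (E ` {1..e}))"
    if m': "input m'" "nat_mem m' ''b'' [] = base" for m'
  proof (rule runs_Seq[where n = "200 * ?N" and k = "100 * codes + (200 * ?N + (1200 * ?M + 300 * ?N))"],
      rule runs_frame[OF runs_power_prog[OF m']], goal_cases)
    case (1 m'')
    have "input m''" by (rule input[OF m'(1)]) (use 1(2,3) in \<open>simp_all add: power_prog_def\<close>)
    moreover have "nat_mem m'' ''b'' [] = base"
      using 1(2) m'(2) by (simp add: power_prog_def)
    ultimately show ?case using 1(1) by (intro digit) auto
  qed simp_all
  have "runs program m (100 * codes + (200 * ?N + (100 * codes + (200 * ?N + (1200 * ?M + 300 * ?N)))))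
      (\<lambda>m'. real_mem m' ''result'' [] = expected_max_score T P (E ` {1..e}))"
    unfolding program_def
  proof (rule runs_Seq[where n = "100 * codes" and k = "200 * ?N + (100 * codes + (200 * ?N + (1200 * ?M + 300 * ?N)))"],
      rule runs_frame[OF runs_base_prog[OF assms]], goal_cases)
    case (1 m'')
    have "input m''" by (rule input[OF assms]) (use 1(2,3) in \<open>simp_all add: base_prog_def\<close>)
    then show ?case using 1(1) by (rule power)
  qed simp_all
  \<comment> \<open>All phases but the main one cost a multiple of \<open>?N\<close> at most, hence
    of \<open>?M\<close>; the coefficients add up to 2100.\<close>
  moreover have "1 * (1 * (1 * ?N)) \<le> ?M"
    using rounds_pos by (intro mult_le_mono) (auto simp: num_teams_def)
  ultimately show ?thesis
    using codes_square by (elim runs_weaken) linarith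
qed

end

text \<open>Program and constant are fixed before \<open>T\<close>, \<open>P\<close> and
  \<open>e\<close>, which enter only through the memory, so the bound is uniform in \<open>e\<close>
  as well. For \<open>rounds T = 0\<close> the logarithm and with it the bound would be 0, which no
  execution can meet.\<close>

theorem theorem1:
  "\<exists>(prog :: com) (C :: real).
     \<forall>(T :: bracket_structure) (P :: nat \<Rightarrow> nat \<Rightarrow> real) (e :: nat)
       (Es :: bracket set) (E :: nat \<Rightarrow> bracket) (m :: memory).
       tournament T \<longrightarrow> rounds T \<ge> 1 \<longrightarrow> win_probabilities T P \<longrightarrow>
       e \<ge> 1 \<longrightarrow> bij_betw E {1..e} Es \<longrightarrow> (\<forall>B\<in>Es. feasible_bracket T B) \<longrightarrow>
       holds_input m T P e E \<longrightarrow>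
       (\<exists>n m'. exec prog m n m' \<and>
          real n \<le> C * (real (num_teams T) *
            (real (num_teams T) * log 2 (real (num_teams T))) ^ (2 * e + 1)) \<and>
          real_mem m' ''result'' [] = expected_max_score T P Es)"
proof (rule exI[of _ program], rule exI[of _ 2500], intro allI impI)
  fix T P e Es E m
  assume asms: "tournament T" "rounds T \<ge> 1" "win_probabilities T P" "e \<ge> 1"
    "bij_betw E {1..e} Es" "\<forall>B\<in>Es. feasible_bracket T B" "holds_input m T P e E"
  have Es: "Es = E ` {1..e}" using asms(5) by (simp add: bij_betw_def)
  interpret bracket_pool T P e E
    using asms by unfold_locales (auto simp: Es)
  have "input m" using asms(7) by (simp add: input_def)
  from runs_program[OF this] obtain n m' where n: "exec program m n m'"
    "n \<le> 2500 * (rounds T * (num_teams T * (num_teams T * (codes * codes))))"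
    "real_mem m' ''result'' [] = expected_max_score T P Es"
    by (auto simp: runs_def Es)
  \<comment> \<open>The number of rounds and one of the two factors \<open>num_teams T\<close> make
    up the last factor \<open>base\<close>; the other one is the leading \<open>t\<close> of the
    bound.\<close>
  have "rounds T * (num_teams T * (num_teams T * (codes * codes))) = num_teams T * (base * (codes * codes))"
    by (simp add: base_def mult_ac)
  also have "base * (codes * codes) = base ^ (2 * e + 1)" by (simp add: power_add mult_2)
  finally have "rounds T * (num_teams T * (num_teams T * (codes * codes))) = num_teams T * base ^ (2 * e + 1)" .
  with n(2) have "real n \<le> 2500 * (real (num_teams T) * real base ^ (2 * e + 1))"
    by (metis of_nat_le_iff of_nat_mult of_nat_numeral of_nat_power)
  also have "real base = real (num_teams T) * log 2 (real (num_teams T))"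
    by (simp add: base_def num_teams_def)
  finally show "\<exists>n m'. exec program m n m' \<and>
      real n \<le> 2500 * (real (num_teams T) * (real (num_teams T) * log 2 (real (num_teams T))) ^ (2 * e + 1)) \<and>
      real_mem m' ''result'' [] = expected_max_score T P Es"
    using n(1,3) by blast
qed

end
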